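(* Let $E\subset\mathbb{R}^n$ be a closed weakly porous set with constants $0<\sigma,\gamma<1$ and let $s\in(0,\frac{1}{1+2^n})$. Then there exists a constant $C_0>0$, dependent on $n$, $s$, $\sigma$ and $\gamma$, such that $\mathcal{L}_{Q_0}(s)\leq C_0\,\mathcal{S}_{Q_0}(s)$ for every cube $Q_0\subset\mathbb{R}^n$ intersecting $E$.
   Context: $|A|$ is the Lebesgue measure of $A$. A cube in $\mathbb{R}^n$ is a half-open set $Q=[a_1,b_1)\times\cdots\times[a_n,b_n)$ with $b_i-a_i>0$ the same for all $i$; this common value is the side length $l(Q)$. For a cube $Q_0$, $\mathcal{D}(Q_0)=\bigcup_{j\geq0}\mathcal{D}^j(Q_0)$, where $\mathcal{D}^j(Q_0)$ is the family of $2^{jn}$ pairwise disjoint cubes of side length $2^{-j}l(Q_0)$ whose union is $Q_0$. For $Q\in\mathcal{D}^j(Q_0)$ with $j\geq1$, $\pi Q$ is the unique cube of $\mathcal{D}^{j-1}(Q_0)$ containing $Q$. Define $\mathcal{D}_E(Q_0)=\{Q\in\mathcal{D}(Q_0): Q\cap\overline{E}=\emptyset,\ \pi Q\cap\overline{E}\neq\emptyset\}$. For a cube $Q$, $\mathcal{M}(Q)$ denotes a cube of maximal side length among the cubes of $\mathcal{D}(Q)$ that are disjoint from $\overline{E}$; when $Q\cap\overline{E}\neq\emptyset$ this is the same as a largest element of $\mathcal{D}_E(Q)$, and when $Q\cap\overline{E}=\emptyset$ it is $Q$ itself. A non-empty set $E\subset\mathbb{R}^n$ is weakly porous with constants $0<\sigma,\gamma<1$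 if for every cube $Q\subset\mathbb{R}^n$ there exist $N=N(Q)\in\mathbb{N}$ and pairwise disjoint $Q_1,\dots,Q_N\in\mathcal{D}(Q)$ such that $Q_i\subset Q\setminus\overline{E}$ and $l(Q_i)\geq\gamma\, l(\mathcal{M}(Q))$ for all $i$, and $\sum_{i=1}^N|Q_i|\geq\sigma|Q|$. For a set $E$ with $|\overline{E}|=0$, a cube $Q_0$ intersecting $\overline{E}$ and $t\in(0,1)$, put $$\mathcal{L}_{Q_0}(t)=\max\Big\{L\geq0:\sum_{Q\in\mathcal{D}_E(Q_0),\,l(Q)\geq L}\tfrac{|Q|}{|Q_0|}\geq t\Big\},\qquad \mathcal{S}_{Q_0}(t)=\min\Big\{L\geq0:\sum_{Q\in\mathcal{D}_E(Q_0),\,l(Q)\leq L}\tfrac{|Q|}{|Q_0|}\geq t\Big\}$$ (these exist and are positive). Closed weakly porous sets have Lebesgue measure zero, so these functions are defined for the $E$ of the claim. *)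

theory Defs
  imports "HOL-Analysis.Analysis"
begin

definition half_open_cube :: "real ^ 'n \<Rightarrow> real \<Rightarrow> (real ^ 'n) set" where
  "half_open_cube a l = {x. \<forall>i. a $ i \<le> x $ i \<and> x $ i < a $ i + l}"

definition is_cube :: "(real ^ 'n) set \<Rightarrow> bool" where
  "is_cube Q \<longleftrightarrow> (\<exists>a l. 0 < l \<and> Q = half_open_cube a l)"

definition side_length :: "(real ^ 'n) set \<Rightarrow> real" where
  "side_length Q = (THE l. 0 < l \<and> (\<exists>a. Q = half_open_cube a l))"

text \<open>The explicit grid; \<open>dyadic_gen_disjoint\<close>, \<open>dyadic_gen_Union\<close>, \<open>dyadic_gen_card\<close> and
  \<open>dyadic_gen_side_length\<close> below confirm that this is the family of \<open>2 ^ (j * n)\<close> pairwise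
  disjoint cubes of side length \<open>2 ^ (- j) * side_length Q\<close> with union \<open>Q\<close>.\<close>

definition dyadic_gen :: "nat \<Rightarrow> (real ^ 'n) set \<Rightarrow> (real ^ 'n) set set" where
  "dyadic_gen j Q =
     {half_open_cube (\<chi> i. a $ i + real (k i) * (l / 2 ^ j)) (l / 2 ^ j) | a l k.
        0 < l \<and> Q = half_open_cube a l \<and> (\<forall>i. k i < (2::nat) ^ j)}"

definition dyadic :: "(real ^ 'n) set \<Rightarrow> (real ^ 'n) set set" where
  "dyadic Q = (\<Union>j. dyadic_gen j Q)"

text \<open>Only meaningful for \<open>Q \<in> dyadic_gen (Suc j) Q0\<close>; see \<open>dyadic_parent_unique\<close>.\<close>

definition dyadic_parent :: "(real ^ 'n) set \<Rightarrow> (real ^ 'n) set \<Rightarrow> (real ^ 'n) set" where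
  "dyadic_parent Q0 Q =
     (THE P. \<exists>j. Q \<in> dyadic_gen (Suc j) Q0 \<and> P \<in> dyadic_gen j Q0 \<and> Q \<subseteq> P)"

text \<open>As \<open>Q0\<close> itself has no parent, the maximal cubes are sought in generations at least one.\<close>

definition dyadic_free :: "(real ^ 'n) set \<Rightarrow> (real ^ 'n) set \<Rightarrow> (real ^ 'n) set set" where
  "dyadic_free E Q0 =
     {Q \<in> (\<Union>j\<in>{1..}. dyadic_gen j Q0).
        Q \<inter> closure E = {} \<and> dyadic_parent Q0 Q \<inter> closure E \<noteq> {}}"

text \<open>If no dyadic subcube of \<open>Q\<close> is disjoint from \<open>closure E\<close>, the value is arbitrary; in that
  case the condition in \<open>weakly_porous\<close> fails for \<open>Q\<close> whatever the value is, since
  \<open>\<sigma> > 0\<close> forces at least one \<open>Qs i\<close> to exist.\<close>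

definition max_free_cube :: "(real ^ 'n) set \<Rightarrow> (real ^ 'n) set \<Rightarrow> (real ^ 'n) set" where
  "max_free_cube E Q = arg_max side_length (\<lambda>R. R \<in> dyadic Q \<and> R \<inter> closure E = {})"

definition weakly_porous :: "real \<Rightarrow> real \<Rightarrow> (real ^ 'n) set \<Rightarrow> bool" where
  "weakly_porous \<sigma> \<gamma> E \<longleftrightarrow>
     E \<noteq> {} \<and> 0 < \<sigma> \<and> \<sigma> < 1 \<and> 0 < \<gamma> \<and> \<gamma> < 1 \<and>
     (\<forall>Q. is_cube Q \<longrightarrow>
       (\<exists>(N::nat) Qs.
          (\<forall>i\<in>{1..N}. Qs i \<in> dyadic Q \<and> Qs i \<subseteq> Q - closure E \<and>
             side_length (Qs i) \<ge> \<gamma> * side_length (max_free_cube E Q)) \<and>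
          disjoint_family_on Qs {1..N} \<and>
          (\<Sum>i=1..N. measure lebesgue (Qs i)) \<ge> \<sigma> * measure lebesgue Q))"

text \<open>The (possibly infinite) sums below range over pairwise disjoint subcubes of \<open>Q0\<close> and hence
  converge. On the reals, \<open>GREATEST\<close> and \<open>LEAST\<close> denote the maximum and the minimum of a
  set whenever these exist, which is the case when \<open>closure E\<close> is a null set, \<open>Q0\<close> is a cube
  meeting \<open>closure E\<close> and \<open>0 < t < 1\<close>.\<close>

definition large_scale :: "(real ^ 'n) set \<Rightarrow> (real ^ 'n) set \<Rightarrow> real \<Rightarrow> real" where
  "large_scale E Q0 t =
     (GREATEST L. 0 \<le> L \<and>
        (\<Sum>\<^sub>\<infinity>Q\<in>{Q \<in> dyadic_free E Q0. side_length Q \<ge> L}.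
           measure lebesgue Q / measure lebesgue Q0) \<ge> t)"

definition small_scale :: "(real ^ 'n) set \<Rightarrow> (real ^ 'n) set \<Rightarrow> real \<Rightarrow> real" where
  "small_scale E Q0 t =
     (LEAST L. 0 \<le> L \<and>
        (\<Sum>\<^sub>\<infinity>Q\<in>{Q \<in> dyadic_free E Q0. side_length Q \<le> L}.
           measure lebesgue Q / measure lebesgue Q0) \<ge> t)"

lemma half_open_cube_eq_iff:
  assumes "0 < l" "0 < m"
  shows "half_open_cube a l = half_open_cube b m \<longleftrightarrow> a = b \<and> l = m"
proof
  assume eq: "half_open_cube a l = half_open_cube b m"
  have "a \<in> half_open_cube b m" "b \<in> half_open_cube a l"
    using assms eq unfolding half_open_cube_def by auto
  then have ab: "a = b"
    by (auto simp: half_open_cube_def vec_eq_iff intro: order_antisym)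
  have "((\<chi> i. a $ i + min l m) \<in> half_open_cube a l) = ((\<chi> i. a $ i + min l m) \<in> half_open_cube b m)"
    using eq by simp
  then have "l = m"
    using assms ab by (auto simp: half_open_cube_def min_def split: if_splits)
  with ab show "a = b \<and> l = m" by simp
qed simp

lemma side_length_half_open_cube [simp]:
  "0 < l \<Longrightarrow> side_length (half_open_cube a l) = l"
  unfolding side_length_def by (rule the_equality) (auto simp: half_open_cube_eq_iff)

lemma dyadic_gen_half_open_cube:
  assumes "0 < l"
  shows "dyadic_gen j (half_open_cube a l) =
    (\<lambda>k. half_open_cube (\<chi> i. a $ i + real (k i) * (l / 2 ^ j)) (l / 2 ^ j)) ` {k. \<forall>i. k i < (2::nat) ^ j}"
  using assms unfolding dyadic_gen_def by (auto simp: half_open_cube_eq_iff)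

lemma dyadic_gen_side_length:
  assumes "Q \<in> dyadic_gen j Q0"
  shows "is_cube Q" "side_length Q = side_length Q0 / 2 ^ j"
proof -
  obtain a l k where 1: "0 < l" "Q0 = half_open_cube a l"
    "Q = half_open_cube (\<chi> i. a $ i + real (k i) * (l / 2 ^ j)) (l / 2 ^ j)"
    using assms unfolding dyadic_gen_def by auto
  have h: "0 < l / 2 ^ j" using 1 by simp
  show "is_cube Q" unfolding is_cube_def using 1(3) h by blast
  show "side_length Q = side_length Q0 / 2 ^ j"
    unfolding 1(3) side_length_half_open_cube[OF h] unfolding 1(2) side_length_half_open_cube[OF 1(1)] ..
qed

lemma mem_grid_cube_iff:
  assumes "0 < (h::real)"
  shows "x \<in> half_open_cube (\<chi> i. a $ i + real (k i) * h) h \<longleftrightarrow>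
    (\<forall>i. \<lfloor>(x $ i - a $ i) / h\<rfloor> = int (k i))"
proof -
  have "(a $ i + real (k i) * h \<le> x $ i \<and> x $ i < a $ i + real (k i) * h + h) \<longleftrightarrow>
      \<lfloor>(x $ i - a $ i) / h\<rfloor> = int (k i)" for i
    using assms by (simp add: floor_eq_iff field_simps)
  then show ?thesis unfolding half_open_cube_def by simp
qed

lemma dyadic_gen_disjoint:
  assumes "Q \<in> dyadic_gen j Q0" "R \<in> dyadic_gen j Q0" "Q \<inter> R \<noteq> {}"
  shows "Q = R"
proof -
  obtain a l k where 1: "0 < l" "Q0 = half_open_cube a l"
    "Q = half_open_cube (\<chi> i. a $ i + real (k i) * (l / 2 ^ j)) (l / 2 ^ j)"
    using assms(1) unfolding dyadic_gen_def by auto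
  obtain k' where 2: "R = half_open_cube (\<chi> i. a $ i + real (k' i) * (l / 2 ^ j)) (l / 2 ^ j)"
    using assms(2) unfolding 1(2) dyadic_gen_half_open_cube[OF 1(1)] by blast
  have h: "0 < l / 2 ^ j" using 1 by simp
  obtain x where "x \<in> Q" "x \<in> R" using assms(3) by auto
  then have "\<forall>i. int (k i) = int (k' i)"
    unfolding 1(3) 2 mem_grid_cube_iff[OF h] by metis
  then show ?thesis using 1 2 by simp
qed

lemma dyadic_gen_Union:
  assumes "is_cube Q0"
  shows "\<Union> (dyadic_gen j Q0) = Q0"
proof -
  obtain a l where 1: "0 < l" "Q0 = half_open_cube a l"
    using assms unfolding is_cube_def by auto
  define h where "h = l / 2 ^ j"
  have h: "0 < h" and l: "l = 2 ^ j * h" using 1 by (simp_all add: h_def)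
  have "x \<in> \<Union> (dyadic_gen j Q0) \<longleftrightarrow> x \<in> Q0" for x
  proof -
    have "x \<in> \<Union> (dyadic_gen j Q0) \<longleftrightarrow>
        (\<exists>k. (\<forall>i. k i < (2::nat) ^ j) \<and> (\<forall>i. \<lfloor>(x $ i - a $ i) / h\<rfloor> = int (k i)))"
      unfolding 1(2) dyadic_gen_half_open_cube[OF 1(1)] h_def[symmetric]
      by (auto simp: mem_grid_cube_iff[OF h])
    also have "\<dots> \<longleftrightarrow> (\<forall>i. \<exists>k. k < (2::nat) ^ j \<and> \<lfloor>(x $ i - a $ i) / h\<rfloor> = int k)"
      by (subst choice_iff) auto
    also have "\<dots> \<longleftrightarrow> (\<forall>i. 0 \<le> \<lfloor>(x $ i - a $ i) / h\<rfloor> \<and> \<lfloor>(x $ i - a $ i) / h\<rfloor> < 2 ^ j)"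
      by (metis (no_types, lifting) nat_eq_iff of_nat_0_le_iff of_nat_less_iff of_nat_numeral of_nat_power)
    also have "\<dots> \<longleftrightarrow> x \<in> Q0"
      using h by (simp add: 1(2) l half_open_cube_def floor_less_iff field_simps)
    finally show ?thesis .
  qed
  then show ?thesis by blast
qed

lemma dyadic_gen_card:
  assumes "is_cube (Q0 :: (real ^ 'n) set)"
  shows "card (dyadic_gen j Q0) = 2 ^ (j * CARD('n))"
proof -
  obtain a l where 1: "0 < l" "Q0 = half_open_cube a l"
    using assms unfolding is_cube_def by auto
  have h: "0 < l / 2 ^ j" using 1 by simp
  have "inj_on (\<lambda>k. half_open_cube (\<chi> i. a $ i + real (k i) * (l / 2 ^ j)) (l / 2 ^ j))
      {k. \<forall>i. k i < (2::nat) ^ j}"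
    by (rule inj_onI) (use 1 in \<open>simp add: half_open_cube_eq_iff vec_eq_iff fun_eq_iff\<close>)
  then have "card (dyadic_gen j Q0) = card {k :: 'n \<Rightarrow> nat. \<forall>i. k i < 2 ^ j}"
    unfolding 1(2) dyadic_gen_half_open_cube[OF 1(1)] by (rule card_image)
  also have "{k :: 'n \<Rightarrow> nat. \<forall>i. k i < 2 ^ j} = PiE UNIV (\<lambda>_. {..<2 ^ j})"
    by (auto simp: PiE_def Pi_def)
  also have "card \<dots> = 2 ^ (j * CARD('n))"
    by (simp add: card_PiE power_mult)
  finally show ?thesis .
qed

lemma dyadic_parent_unique:
  assumes Q: "Q \<in> dyadic_gen (Suc j) Q0"
  shows "\<exists>!P. P \<in> dyadic_gen j Q0 \<and> Q \<subseteq> P"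
    and "dyadic_parent Q0 Q \<in> dyadic_gen j Q0"
    and "Q \<subseteq> dyadic_parent Q0 Q"
proof -
  obtain a l k where 1: "0 < l" "Q0 = half_open_cube a l" "\<forall>i. k i < (2::nat) ^ Suc j"
    "Q = half_open_cube (\<chi> i. a $ i + real (k i) * (l / 2 ^ Suc j)) (l / 2 ^ Suc j)"
    using Q unfolding dyadic_gen_def by auto
  define h where "h = l / 2 ^ Suc j"
  have h: "0 < h" "l / 2 ^ j = 2 * h" using 1 by (simp_all add: h_def)
  define P where "P = half_open_cube (\<chi> i. a $ i + real (k i div 2) * (l / 2 ^ j)) (l / 2 ^ j)"
  have P: "P \<in> dyadic_gen j Q0"
    unfolding 1(2) P_def dyadic_gen_half_open_cube[OF 1(1)]
    by (rule image_eqI[where x = "\<lambda>i. k i div 2"]) (use 1(3) in \<open>auto simp: less_mult_imp_div_less mult.commute\<close>)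
  have QP: "Q \<subseteq> P"
  proof
    fix x assume "x \<in> Q"
    then have x: "a $ i + real (k i) * h \<le> x $ i \<and> x $ i < a $ i + real (k i) * h + h" for i
      unfolding 1(4) h_def[symmetric] half_open_cube_def by simp
    have "a $ i + real (k i div 2) * (2 * h) \<le> x $ i \<and> x $ i < a $ i + real (k i div 2) * (2 * h) + 2 * h" for i
    proof -
      have "2 * (k i div 2) \<le> k i" "k i + 1 \<le> 2 * (k i div 2) + 2" by presburger+
      then have "2 * real (k i div 2) \<le> real (k i)" "real (k i) + 1 \<le> 2 * real (k i div 2) + 2"
        by linarith+
      then have "(2 * real (k i div 2)) * h \<le> real (k i) * h"
        "(real (k i) + 1) * h \<le> (2 * real (k i div 2) + 2) * h"
        using h(1) by (meson less_imp_le mult_right_mono)+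
      then have "real (k i div 2) * (2 * h) \<le> real (k i) * h"
        "real (k i) * h + h \<le> real (k i div 2) * (2 * h) + 2 * h"
        unfolding distrib_right by simp_all
      with x[of i] show ?thesis by linarith
    qed
    then show "x \<in> P" unfolding P_def h(2) half_open_cube_def by simp
  qed
  have ne: "Q \<noteq> {}"
  proof -
    have "(\<chi> i. a $ i + real (k i) * h) \<in> Q"
      using h(1) unfolding 1(4) h_def[symmetric] half_open_cube_def by simp
    then show ?thesis by blast
  qed
  have uniq: "P' = P" if "P' \<in> dyadic_gen j Q0" "Q \<subseteq> P'" for P'
    using dyadic_gen_disjoint[OF that(1) P] that(2) QP ne by blast
  show "\<exists>!P. P \<in> dyadic_gen j Q0 \<and> Q \<subseteq> P"
    using P QP uniq by blast
  have level: "j' = j" if "Q \<in> dyadic_gen (Suc j') Q0" for j'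
  proof -
    have "l / 2 ^ Suc j' = l / 2 ^ Suc j"
      using dyadic_gen_side_length(2)[OF that] dyadic_gen_side_length(2)[OF Q] 1(1,2) by simp
    then show ?thesis using 1(1) by simp
  qed
  have "dyadic_parent Q0 Q = P"
    unfolding dyadic_parent_def
    by (rule the_equality) (use P QP Q uniq level in blast)+
  then show "dyadic_parent Q0 Q \<in> dyadic_gen j Q0" "Q \<subseteq> dyadic_parent Q0 Q"
    using P QP by simp_all
qed

end

theory Submission
  imports Defs
begin

text \<open>Weak porosity makes the maximal hole doubling: if \<open>Q'\<close> is a cube in \<open>Q\<close> whose slightly shrunken
  copy has measure more than \<open>(1 - \<sigma>) |Q|\<close>, then one of the holes filling the proportion \<open>\<sigma>\<close> of
  \<open>Q\<close> meets this copy, hence meets \<open>Q'\<close> in a hole of comparable size; finitely many such shrinkings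
  lead from \<open>Q\<close> to a dyadic child. Below the scale of the holes found in \<open>Q\<close>, the rest of \<open>Q\<close> is
  thus made of dyadic cubes that still have comparable holes, and these again fill the
  proportion \<open>\<sigma>\<close>. After \<open>m\<close> rounds the holes of side at least \<open>c\<^sup>m\<close> times the largest one leave
  at most \<open>(1 - \<sigma>)\<^sup>m |Q|\<close> uncovered. As soon as \<open>(1 - \<sigma>)\<^sup>m < s\<close>, the smaller holes
  have total mass below \<open>s\<close>, so the small scale is at least \<open>c\<^sup>m\<close> times the largest hole, which in
  turn bounds the large scale.\<close>

section \<open>Inclusion and volume of half-open cubes\<close>

lemma half_open_cube_subset_iff:
  fixes a b :: "real ^ 'n"
  assumes "0 < r"
  shows "half_open_cube b r \<subseteq> half_open_cube a l \<longleftrightarrow>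
    (\<forall>i. a $ i \<le> b $ i \<and> b $ i + r \<le> a $ i + l)"
proof
  assume sub: "half_open_cube b r \<subseteq> half_open_cube a l"
  have b: "b \<in> half_open_cube a l"
    using sub assms by (auto simp: half_open_cube_def)
  show "\<forall>i. a $ i \<le> b $ i \<and> b $ i + r \<le> a $ i + l"
  proof
    fix i
    \<comment> \<open>The upper end of a half-open side is not attained, so the bound comes from
      letting coordinate \<open>i\<close> of \<open>b\<close> increase towards
      \<open>b $ i + r\<close>.\<close>
    have "b $ i + r \<le> a $ i + l"
    proof (rule dense_le_bounded)
      show "b $ i < b $ i + r" using assms by simp
      fix w assume w: "b $ i < w" "w < b $ i + r"
      have "(\<chi> k. if k = i then w else b $ k) \<in> half_open_cube b r"
        using assms w by (auto simp: half_open_cube_def)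
      with sub have "(\<chi> k. if k = i then w else b $ k) \<in> half_open_cube a l" by blast
      then show "w \<le> a $ i + l"
        by (force simp: half_open_cube_def dest: spec[where x = i])
    qed
    with b show "a $ i \<le> b $ i \<and> b $ i + r \<le> a $ i + l" by (simp add: half_open_cube_def)
  qed
next
  assume "\<forall>i. a $ i \<le> b $ i \<and> b $ i + r \<le> a $ i + l"
  then show "half_open_cube b r \<subseteq> half_open_cube a l"
    unfolding half_open_cube_def by (smt (verit) mem_Collect_eq subsetI)
qed

lemma half_open_cube_subset_side_le:
  fixes a b :: "real ^ 'n"
  assumes "0 < r" "half_open_cube b r \<subseteq> half_open_cube a l"
  shows "r \<le> l"
proof -
  \<comment> \<open>Index types are inhabited, so there is a coordinate in which to compare the
    sides.\<close>
  obtain i :: 'n where True by simp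
  have "a $ i \<le> b $ i \<and> b $ i + r \<le> a $ i + l"
    using assms half_open_cube_subset_iff by blast
  then show ?thesis by linarith
qed

lemma half_open_cube_subset_cbox:
  "half_open_cube (a :: real ^ 'n) l \<subseteq> cbox a (\<chi> i. a $ i + l)"
  by (auto simp: half_open_cube_def mem_box_cart order.strict_implies_order)

lemma half_open_cube_lmeasurable [simp]:
  "half_open_cube (a :: real ^ 'n) l \<in> lmeasurable"
proof (rule bounded_set_imp_lmeasurable)
  show "bounded (half_open_cube a l)"
    using bounded_cbox bounded_subset half_open_cube_subset_cbox by blast
  have "half_open_cube a l = (\<Inter>i. {x. a $ i \<le> x $ i} \<inter> {x. x $ i < a $ i + l})"
    by (auto simp: half_open_cube_def)
  also have "\<dots> \<in> sets borel"
    by (intro sets.countable_INT'' sets.Int countable_finite borel_closed borel_open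
        closed_Collect_le open_Collect_less continuous_intros) auto
  finally show "half_open_cube a l \<in> sets lebesgue" by simp
qed

text \<open>The cube lies between the open and the closed box with the same corners, which have
  equal content.\<close>

lemma measure_half_open_cube:
  fixes a :: "real ^ 'n"
  assumes "0 < l"
  shows "measure lebesgue (half_open_cube a l) = l ^ CARD('n)"
proof -
  let ?b = "\<chi> i. a $ i + l"
  have ne: "cbox a ?b \<noteq> {}"
    using assms by (simp add: interval_ne_empty_cart)
  have cb: "measure lebesgue (cbox a ?b) = l ^ CARD('n)"
    using content_cbox_cart[OF ne] by simp
  have "measure lebesgue (box a ?b) = measure lebesgue (cbox a ?b)"
    by (simp add: measure_lborel_box_eq measure_lborel_cbox_eq)
  moreover have "measure lebesgue (box a ?b) \<le> measure lebesgue (half_open_cube a l)"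
    by (rule measure_mono_fmeasurable[OF _ _ half_open_cube_lmeasurable])
      (auto simp: half_open_cube_def mem_box_cart order.strict_implies_order)
  moreover have "measure lebesgue (half_open_cube a l) \<le> measure lebesgue (cbox a ?b)"
    by (rule measure_mono_fmeasurable[OF half_open_cube_subset_cbox]) (simp_all add: fmeasurableD)
  ultimately show ?thesis using cb by linarith
qed

lemma measure_cube_pos:
  "is_cube (Q :: (real ^ 'n) set) \<Longrightarrow> 0 < measure lebesgue Q"
  unfolding is_cube_def by (auto simp: measure_half_open_cube)

section \<open>Nesting of dyadic generations\<close>

lemma finite_dyadic_gen:
  assumes "is_cube (Q :: (real ^ 'n) set)"
  shows "finite (dyadic_gen j Q)"
  using dyadic_gen_card[OF assms, of j] card.infinite by fastforce

lemma dyadic_gen_0: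
  assumes "is_cube (Q :: (real ^ 'n) set)"
  shows "dyadic_gen 0 Q = {Q}"
proof -
  obtain a l where "0 < l" "Q = half_open_cube a l" using assms unfolding is_cube_def by auto
  then show ?thesis by (auto simp: dyadic_gen_half_open_cube)
qed

text \<open>Division of a grid position of generation \<open>i + j\<close> by \<open>2 ^ j\<close>
  gives as quotient the position of the ancestor in generation \<open>i\<close> and as remainder the
  position inside that ancestor.\<close>

lemma dyadic_gen_add:
  assumes "is_cube (Q :: (real ^ 'n) set)"
  shows "dyadic_gen (i + j) Q = (\<Union>R\<in>dyadic_gen i Q. dyadic_gen j R)"
proof -
  obtain a l where 1: "0 < l" "Q = half_open_cube a l" using assms unfolding is_cube_def by auto
  define h where "h = l / 2 ^ (i + j)"
  have h: "l / 2 ^ i = 2 ^ j * h" "l / 2 ^ i / 2 ^ j = h" "0 < l / 2 ^ i"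
    using 1 by (simp_all add: h_def power_add)
  have gen: "dyadic_gen j (half_open_cube b (l / 2 ^ i)) =
      (\<lambda>k. half_open_cube (\<chi> i. b $ i + real (k i) * h) h) ` {k. \<forall>i. k i < (2::nat) ^ j}" for b
    unfolding dyadic_gen_half_open_cube[OF h(3)] h(2) ..
  show ?thesis
  proof (intro equalityI subsetI)
    fix S assume "S \<in> dyadic_gen (i + j) Q"
    then obtain K where K: "\<forall>t. K t < (2::nat) ^ (i + j)"
      "S = half_open_cube (\<chi> t. a $ t + real (K t) * h) h"
      unfolding 1(2) dyadic_gen_half_open_cube[OF 1(1)] h_def by auto
    let ?R = "half_open_cube (\<chi> t. a $ t + real (K t div 2 ^ j) * (l / 2 ^ i)) (l / 2 ^ i)"
    have "?R \<in> dyadic_gen i Q"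
      unfolding 1(2) dyadic_gen_half_open_cube[OF 1(1)]
      by (rule image_eqI[where x = "\<lambda>t. K t div 2 ^ j"])
        (use K(1) in \<open>auto simp: power_add less_mult_imp_div_less mult.commute\<close>)
    moreover have "S \<in> dyadic_gen j ?R"
      unfolding gen
    proof (rule image_eqI[where x = "\<lambda>t. K t mod 2 ^ j"])
      have "real (K t) * h = real (K t div 2 ^ j) * (l / 2 ^ i) + real (K t mod 2 ^ j) * h" for t
      proof -
        have "real (K t) = real (K t div 2 ^ j * 2 ^ j + K t mod 2 ^ j)"
          by (simp only: div_mult_mod_eq)
        then have "real (K t) = real (K t div 2 ^ j) * 2 ^ j + real (K t mod 2 ^ j)"
          by simp
        then show ?thesis unfolding h(1) by (metis distrib_right mult.assoc)
      qed
      then show "S = half_open_cube (\<chi> i'. (\<chi> t. a $ t + real (K t div 2 ^ j) * (l / 2 ^ i)) $ i' +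
          real (K i' mod 2 ^ j) * h) h"
        unfolding K(2) by (simp add: add.assoc)
    qed auto
    ultimately show "S \<in> (\<Union>R\<in>dyadic_gen i Q. dyadic_gen j R)" by blast
  next
    fix S assume "S \<in> (\<Union>R\<in>dyadic_gen i Q. dyadic_gen j R)"
    then obtain R where "R \<in> dyadic_gen i Q" and S: "S \<in> dyadic_gen j R" by auto
    then obtain k where k: "\<forall>t. k t < (2::nat) ^ i"
      "R = half_open_cube (\<chi> t. a $ t + real (k t) * (l / 2 ^ i)) (l / 2 ^ i)"
      unfolding 1(2) dyadic_gen_half_open_cube[OF 1(1)] by auto
    obtain k' where k': "\<forall>t. k' t < (2::nat) ^ j"
      "S = half_open_cube (\<chi> t. (\<chi> t. a $ t + real (k t) * (l / 2 ^ i)) $ t + real (k' t) * h) h"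
      using S unfolding k(2) gen by auto
    have "k t * 2 ^ j + k' t < 2 ^ (i + j)" for t
    proof -
      have "k t * 2 ^ j + k' t < (k t + 1) * 2 ^ j" using k'(1) by simp
      also have "\<dots> \<le> 2 ^ i * 2 ^ j" using k(1) by (intro mult_right_mono) (auto simp: Suc_leI)
      finally show ?thesis by (simp add: power_add)
    qed
    moreover have "S = half_open_cube (\<chi> t. a $ t + real (k t * 2 ^ j + k' t) * h) h"
      unfolding k'(2) h(1) by (simp add: algebra_simps)
    ultimately show "S \<in> dyadic_gen (i + j) Q"
      unfolding 1(2) dyadic_gen_half_open_cube[OF 1(1)] h_def[symmetric]
      by (intro image_eqI[where x = "\<lambda>t. k t * 2 ^ j + k' t"]) auto
  qed
qed

lemma dyadic_gen_subset:
  assumes "R \<in> dyadic_gen j (Q :: (real ^ 'n) set)"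
  shows "R \<subseteq> Q"
proof -
  have "is_cube Q" using assms unfolding dyadic_gen_def is_cube_def by auto
  then show ?thesis using dyadic_gen_Union assms by blast
qed

text \<open>The ancestor of \<open>S\<close> in generation \<open>i\<close> meets \<open>R\<close>,
  and two cubes of one generation that meet are equal.\<close>

lemma dyadic_nested:
  assumes "is_cube (Q :: (real ^ 'n) set)" "R \<in> dyadic_gen i Q" "S \<in> dyadic_gen (i + j) Q" "R \<inter> S \<noteq> {}"
  shows "S \<in> dyadic_gen j R"
proof -
  obtain R' where R': "R' \<in> dyadic_gen i Q" "S \<in> dyadic_gen j R'"
    using assms(3) unfolding dyadic_gen_add[OF assms(1)] by blast
  then have "R' \<inter> R \<noteq> {}" using assms(4) dyadic_gen_subset by blast
  then show ?thesis using dyadic_gen_disjoint R' assms(2) by metis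
qed

lemma dyadic_is_cube:
  assumes "R \<in> dyadic (Q :: (real ^ 'n) set)"
  shows "is_cube R" "R \<subseteq> Q"
  using assms dyadic_gen_side_length dyadic_gen_subset unfolding dyadic_def by blast+

lemma countable_dyadic:
  assumes "is_cube (Q :: (real ^ 'n) set)"
  shows "countable (dyadic Q)"
  unfolding dyadic_def using finite_dyadic_gen[OF assms] by (blast intro: countable_finite)

lemma dyadic_split:
  assumes "is_cube (Q :: (real ^ 'n) set)"
  shows "dyadic Q = insert Q (\<Union>R\<in>dyadic_gen 1 Q. dyadic R)"
proof -
  have "dyadic Q = dyadic_gen 0 Q \<union> (\<Union>j. dyadic_gen (Suc j) Q)"
  proof -
    have "R \<in> dyadic_gen 0 Q \<union> (\<Union>j. dyadic_gen (Suc j) Q)" if "R \<in> dyadic_gen j Q" for R j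
      using that by (cases j) auto
    then show ?thesis unfolding dyadic_def by blast
  qed
  also have "(\<Union>j. dyadic_gen (Suc j) Q) = (\<Union>R\<in>dyadic_gen 1 Q. dyadic R)"
    unfolding dyadic_def using dyadic_gen_add[OF assms, of 1] by (simp only: plus_1_eq_Suc) blast
  finally show ?thesis using dyadic_gen_0[OF assms] by simp
qed

text \<open>A dyadic cube containing the centre of the small cube stays inside it once its side is
  at most \<open>r / 2\<close>. In the first such generation the side is still at least
  \<open>r / 4\<close>, since the generation before is too coarse.\<close>

lemma exists_dyadic_subcube:
  fixes a b :: "real ^ 'n"
  assumes "0 < l" "0 < r" "half_open_cube b r \<subseteq> half_open_cube a l"
  obtains R where "R \<in> dyadic (half_open_cube a l)" "R \<subseteq> half_open_cube b r" "r / 4 \<le> side_length R"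
proof -
  let ?Q = "half_open_cube a l"
  have Q: "is_cube ?Q" using assms(1) unfolding is_cube_def by blast
  have rl: "r \<le> l" by (rule half_open_cube_subset_side_le[OF assms(2,3)])
  define j where "j = (LEAST j. l / 2 ^ j \<le> r / 2)"
  have ex: "\<exists>j. l / 2 ^ j \<le> r / 2"
  proof -
    obtain j where "l / (r / 2) < 2 ^ j" using real_arch_pow[of 2] by auto
    then have "l / 2 ^ j \<le> r / 2" using assms by (simp add: field_simps)
    then show ?thesis ..
  qed
  have j: "l / 2 ^ j \<le> r / 2" unfolding j_def using ex by (rule LeastI_ex)
  have "j \<noteq> 0" using j rl assms by (intro notI) simp
  then obtain i where i: "j = Suc i" using not0_implies_Suc by blast
  have "\<not> l / 2 ^ i \<le> r / 2" using not_less_Least[of i "\<lambda>j. l / 2 ^ j \<le> r / 2"] i unfolding j_def by simp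
  then have j4: "r / 4 \<le> l / 2 ^ j" unfolding i by (simp add: field_simps)
  define x where "x = (\<chi> i. b $ i + r / 2)"
  have "x \<in> half_open_cube b r" using assms(2) by (simp add: x_def half_open_cube_def)
  then obtain R where R: "R \<in> dyadic_gen j ?Q" "x \<in> R"
    using assms(3) dyadic_gen_Union[OF Q, of j] by blast
  obtain p where p: "R = half_open_cube p (l / 2 ^ j)"
    using R(1) unfolding dyadic_gen_half_open_cube[OF assms(1)] by blast
  have "p $ i \<le> b $ i + r / 2 \<and> b $ i + r / 2 < p $ i + l / 2 ^ j" for i
    using R(2) unfolding p x_def half_open_cube_def by simp
  then have "b $ i \<le> p $ i \<and> p $ i + l / 2 ^ j \<le> b $ i + r" for i
    using j by (smt (verit) field_sum_of_halves)
  then have "R \<subseteq> half_open_cube b r"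
    unfolding p using half_open_cube_subset_iff assms(1) by (metis divide_pos_pos zero_less_numeral zero_less_power)
  moreover have "side_length R = l / 2 ^ j" using p assms(1) by simp
  ultimately show thesis using that[of R] R(1) j4 unfolding dyadic_def by auto
qed

section \<open>Holes and the set covered by large free cubes\<close>

definition free_union :: "(real ^ 'n) set \<Rightarrow> (real ^ 'n) set \<Rightarrow> real \<Rightarrow> (real ^ 'n) set" where
  "free_union E Q c = \<Union>{R \<in> dyadic Q. R \<inter> E = {} \<and> c \<le> side_length R}"

text \<open>Holes need not be dyadic, so they can be passed between cubes of different
  grids.\<close>

definition has_hole :: "(real ^ 'n) set \<Rightarrow> (real ^ 'n) set \<Rightarrow> real \<Rightarrow> bool" where
  "has_hole E Q r \<longleftrightarrow> (\<exists>b. half_open_cube b r \<subseteq> Q - E)"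

text \<open>The form in which weak porosity is used. The hole need not be the largest one, and the
  cube is arbitrary because the passage to a dyadic child goes through cubes off the grid.\<close>

definition hole_filling :: "real \<Rightarrow> real \<Rightarrow> (real ^ 'n) set \<Rightarrow> bool" where
  "hole_filling \<sigma> \<delta> E \<longleftrightarrow>
    (\<forall>a l r. 0 < l \<longrightarrow> 0 < r \<longrightarrow> has_hole E (half_open_cube a l) r \<longrightarrow>
      \<sigma> * l ^ CARD('n) \<le> measure lebesgue (free_union E (half_open_cube a l) (\<delta> * r)))"

lemma has_hole_mono:
  assumes "has_hole E Q r" "0 < r'" "r' \<le> r"
  shows "has_hole E Q r'"
proof -
  obtain b where "half_open_cube b r \<subseteq> Q - E" using assms(1) unfolding has_hole_def by blast
  moreover have "half_open_cube b r' \<subseteq> half_open_cube b r"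
    unfolding half_open_cube_subset_iff[OF assms(2)] using assms(3) by simp
  ultimately show ?thesis unfolding has_hole_def by blast
qed

lemma free_union_subset: "free_union E Q c \<subseteq> Q"
  unfolding free_union_def using dyadic_is_cube by blast

lemma free_union_lmeasurable:
  assumes "is_cube (Q :: (real ^ 'n) set)"
  shows "free_union E Q c \<in> lmeasurable"
proof (rule bounded_set_imp_lmeasurable)
  obtain a l where Q: "0 < l" "Q = half_open_cube a l" using assms unfolding is_cube_def by auto
  show "bounded (free_union E Q c)"
    using bounded_cbox bounded_subset free_union_subset half_open_cube_subset_cbox
    unfolding Q(2) by (metis (no_types))
  show "free_union E Q c \<in> sets lebesgue"
    unfolding free_union_def
  proof (rule sets.countable_Union)
    show "countable {R \<in> dyadic Q. R \<inter> E = {} \<and> c \<le> side_length R}"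
      by (rule countable_subset[OF _ countable_dyadic[OF assms]]) auto
    show "{R \<in> dyadic Q. R \<inter> E = {} \<and> c \<le> side_length R} \<subseteq> sets lebesgue"
      using dyadic_is_cube(1) half_open_cube_lmeasurable unfolding is_cube_def
      by (metis (no_types, lifting) fmeasurableD mem_Collect_eq subsetI)
  qed
qed


lemma in_free_unionE:
  assumes "x \<in> free_union E Q c"
  obtains p \<rho> where "0 < \<rho>" "c \<le> \<rho>" "x \<in> half_open_cube p \<rho>" "half_open_cube p \<rho> \<subseteq> Q - E"
proof -
  obtain R where R: "R \<in> dyadic Q" "R \<inter> E = {}" "c \<le> side_length R" "x \<in> R"
    using assms unfolding free_union_def by auto
  obtain p \<rho> where p: "0 < \<rho>" "R = half_open_cube p \<rho>"
    using dyadic_is_cube(1)[OF R(1)] unfolding is_cube_def by auto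
  show thesis
    using that[of \<rho> p] p R dyadic_is_cube(2)[OF R(1)] by auto
qed

section \<open>Passing holes to smaller cubes\<close>

text \<open>A concentric copy of the smaller cube is too large to avoid the holes that fill the
  proportion \<sigma>. A common point lies in a free cube of side at least
  \<open>\<delta> * r\<close> and away from the boundary of the smaller cube, which leaves room for
  a hole.\<close>

lemma has_hole_slightly_smaller_cube:
  fixes E :: "(real ^ 'n) set"
  assumes fill: "hole_filling \<sigma> \<delta> E"
    and \<theta>: "0 < \<theta>" "\<theta> < 1" "1 - \<sigma> < \<theta> ^ (2 * CARD('n))"
    and "0 < \<delta>" "0 < l" "\<theta> * l \<le> l'"
    and sub: "half_open_cube a' l' \<subseteq> half_open_cube a l"
    and r: "0 < r" "has_hole E (half_open_cube a l) r"
  shows "has_hole E (half_open_cube a' l') (min \<delta> ((1 - \<theta>) * \<theta> / 2) * r)"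
proof -
  let ?Q = "half_open_cube a l" and ?n = "CARD('n)"
  let ?U = "free_union E ?Q (\<delta> * r)"
  have Q: "is_cube ?Q" using \<open>0 < l\<close> unfolding is_cube_def by blast
  have "0 < \<theta> * l" using \<theta>(1) \<open>0 < l\<close> by simp
  then have l': "0 < l'" using \<open>\<theta> * l \<le> l'\<close> by linarith
  obtain b0 where "half_open_cube b0 r \<subseteq> ?Q - E" using r(2) unfolding has_hole_def by blast
  then have rl: "r \<le> l" using half_open_cube_subset_side_le[OF r(1)] by blast
  define d where "d = (1 - \<theta>) * l' / 2"
  have d: "0 < d" "2 * d + \<theta> * l' = l'" using \<theta> l' by (simp_all add: d_def field_simps)
  define I where "I = half_open_cube (\<chi> i. a' $ i + d) (\<theta> * l')"
  have I: "x \<in> I \<longleftrightarrow> (\<forall>i. a' $ i + d \<le> x $ i \<and> x $ i < a' $ i + l' - d)" for x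
  proof -
    have "a' $ i + d + \<theta> * l' = a' $ i + l' - d" for i using d(2) by linarith
    then show ?thesis unfolding I_def half_open_cube_def by (simp only: mem_Collect_eq vec_lambda_beta)
  qed
  have tl: "0 < \<theta> * l'" using \<theta> l' by simp
  have "I \<subseteq> half_open_cube a' l'"
  proof
    fix x assume "x \<in> I"
    then have "a' $ i \<le> x $ i \<and> x $ i < a' $ i + l'" for i using I[of x] d(1) by (smt (verit))
    then show "x \<in> half_open_cube a' l'" unfolding half_open_cube_def by simp
  qed
  then have IQ: "I \<subseteq> ?Q" using sub by blast
  have "\<not> I \<inter> ?U = {}"
  proof
    assume disj: "I \<inter> ?U = {}"
    have U: "?U \<in> lmeasurable" by (rule free_union_lmeasurable[OF Q])
    have Im: "I \<in> lmeasurable" unfolding I_def by simp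
    \<comment> \<open>One factor \<theta> in the side pays for \<open>\<theta> * l \<le> l'\<close>,
      the other for shrinking to \<open>I\<close>; hence the exponent \<open>2 * ?n\<close>.\<close>
    have "(1 - \<sigma>) * l ^ ?n < \<theta> ^ (2 * ?n) * l ^ ?n" using \<theta>(3) \<open>0 < l\<close> by simp
    also have "\<dots> = (\<theta> * (\<theta> * l)) ^ ?n" by (simp add: power_mult_distrib power_mult power2_eq_square)
    also have "\<dots> \<le> (\<theta> * l') ^ ?n"
      using \<theta> \<open>0 < l\<close> \<open>\<theta> * l \<le> l'\<close> by (intro power_mono mult_left_mono) auto
    also have "\<dots> = measure lebesgue I" unfolding I_def measure_half_open_cube[OF tl] ..
    finally have "(1 - \<sigma>) * l ^ ?n < measure lebesgue I" .
    moreover have "\<sigma> * l ^ ?n \<le> measure lebesgue ?U"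
      using fill \<open>0 < l\<close> r unfolding hole_filling_def by blast
    moreover have "measure lebesgue (I \<union> ?U) = measure lebesgue I + measure lebesgue ?U"
      using measure_Un3[OF Im U] disj by simp
    moreover have "measure lebesgue (I \<union> ?U) \<le> measure lebesgue ?Q"
      using IQ free_union_subset[of E ?Q] Im U
      by (intro measure_mono_fmeasurable) auto
    ultimately show False
      using measure_half_open_cube[OF \<open>0 < l\<close>, of a] by (simp add: algebra_simps)
  qed
  then obtain x where x: "x \<in> I" "x \<in> ?U" by blast
  obtain p \<rho> where p: "0 < \<rho>" "\<delta> * r \<le> \<rho>" "x \<in> half_open_cube p \<rho>" "half_open_cube p \<rho> \<subseteq> ?Q - E"
    by (rule in_free_unionE[OF x(2)])
  \<comment> \<open>The factor \<delta> keeps \<open>q\<close> below the side \<rho> of the free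
    cube; the other factor, with \<open>r \<le> l\<close> and \<open>\<theta> * l \<le> l'\<close>,
    keeps \<open>q\<close> below the margin \<open>d\<close>.\<close>
  define q where "q = min \<delta> ((1 - \<theta>) * \<theta> / 2) * r"
  have q: "0 < q" using r(1) \<theta> \<open>0 < \<delta>\<close> by (simp add: q_def)
  have "q \<le> \<delta> * r" unfolding q_def using r(1) by (intro mult_right_mono) auto
  then have q\<rho>: "q \<le> \<rho>" using p(2) by linarith
  have "q \<le> ((1 - \<theta>) * \<theta> / 2) * r" unfolding q_def using r(1) by (intro mult_right_mono) auto
  also have "\<dots> \<le> ((1 - \<theta>) * \<theta> / 2) * l" using rl \<theta> by (intro mult_left_mono) auto
  also have "\<dots> = (1 - \<theta>) / 2 * (\<theta> * l)" by simp
  also have "\<dots> \<le> (1 - \<theta>) / 2 * l'" using \<open>\<theta> * l \<le> l'\<close> \<theta> by (intro mult_left_mono) auto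
  finally have qd: "q \<le> d" by (simp add: d_def)
  \<comment> \<open>In each coordinate the hole ends at \<open>x\<close> unless it would leave the
    free cube at \<open>p\<close>; then it starts at \<open>p\<close>. It never goes further than
    \<open>q \<le> d\<close> from \<open>x\<close>, so it stays in the smaller cube.\<close>
  define b where "b = (\<chi> i. max (p $ i) (x $ i - q))"
  have xp: "p $ i \<le> x $ i \<and> x $ i < p $ i + \<rho>" for i
    using p(3) unfolding half_open_cube_def by blast
  have "half_open_cube b q \<subseteq> half_open_cube p \<rho>"
    unfolding half_open_cube_subset_iff[OF q]
  proof
    fix i
    show "p $ i \<le> b $ i \<and> b $ i + q \<le> p $ i + \<rho>"
      using xp[of i] q\<rho> unfolding b_def by auto
  qed
  moreover have "half_open_cube b q \<subseteq> half_open_cube a' l'"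
    unfolding half_open_cube_subset_iff[OF q]
  proof
    fix i
    have "a' $ i + d \<le> x $ i \<and> x $ i < a' $ i + l' - d" using x(1) I by blast
    then show "a' $ i \<le> b $ i \<and> b $ i + q \<le> a' $ i + l'"
      using xp[of i] qd d(1) unfolding b_def by auto
  qed
  ultimately show ?thesis
    using p(4) unfolding has_hole_def q_def[symmetric] by blast
qed

text \<open>The smaller cube is reached through nested cubes whose successive side ratios are at
  least \<theta>, so each step is a slight shrinking.\<close>

lemma has_hole_smaller_cube:
  fixes E :: "(real ^ 'n) set"
  assumes fill: "hole_filling \<sigma> \<delta> E"
    and \<theta>: "0 < \<theta>" "\<theta> < 1" "1 - \<sigma> < \<theta> ^ (2 * CARD('n))"
    and "0 < \<delta>"
    and "0 < l" "0 < l'" "\<theta> ^ Suc m * l \<le> l'"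
    and "half_open_cube a' l' \<subseteq> half_open_cube a l"
    and "0 < r" "has_hole E (half_open_cube a l) r"
  shows "has_hole E (half_open_cube a' l') (min \<delta> ((1 - \<theta>) * \<theta> / 2) ^ Suc m * r)"
  using assms(6-)
proof (induction m arbitrary: a' l')
  case 0
  then show ?case using has_hole_slightly_smaller_cube[OF fill \<theta> \<open>0 < \<delta>\<close>] by simp
next
  case (Suc m)
  define \<kappa> where "\<kappa> = min \<delta> ((1 - \<theta>) * \<theta> / 2)"
  have \<kappa>: "0 < \<kappa>" "\<kappa> < 1"
    using \<theta> \<open>0 < \<delta>\<close> mult_strict_mono[of "1 - \<theta>" 1 \<theta> 1] by (auto simp: \<kappa>_def min_less_iff_disj)
  have sub: "a $ i \<le> a' $ i \<and> a' $ i + l' \<le> a $ i + l" for i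
    using Suc.prems half_open_cube_subset_iff by blast
  \<comment> \<open>The intermediate cube has the target side enlarged by
    \<open>1 / \<theta>\<close>, capped at \<open>l\<close>, and keeps the upper ends of the target
    unless it would leave the large cube. The induction hypothesis reaches it from the large cube;
    one more shrinking leads to the target.\<close>
  define l'' where "l'' = min l (l' / \<theta>)"
  define a'' where "a'' = (\<chi> i. max (a $ i) (a' $ i + l' - l''))"
  have l'l: "l' \<le> l" by (rule half_open_cube_subset_side_le) (use Suc.prems in auto)
  have l''0: "0 < l''" using Suc.prems \<theta> by (simp add: l''_def)
  have "l' \<le> l' / \<theta>" using \<theta> Suc.prems by (simp add: field_simps mult_left_le)
  then have l'l'': "l' \<le> l''" "l'' \<le> l" using l'l by (auto simp: l''_def)
  have "\<theta> * l'' \<le> \<theta> * (l' / \<theta>)" using \<theta> by (intro mult_left_mono) (auto simp: l''_def)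
  then have \<theta>l'': "\<theta> * l'' \<le> l'" using \<theta> by simp
  have "\<theta> ^ Suc m * l \<le> l' / \<theta>" using Suc.prems(3) \<theta> by (simp add: field_simps)
  moreover have "\<theta> ^ Suc m * l \<le> l"
    using \<theta> Suc.prems(1) power_le_one[of \<theta> "Suc m"] mult_right_mono[of "\<theta> ^ Suc m" 1 l] by simp
  ultimately have "\<theta> ^ Suc m * l \<le> l''" by (simp add: l''_def)
  moreover have "half_open_cube a'' l'' \<subseteq> half_open_cube a l"
    unfolding half_open_cube_subset_iff[OF l''0]
  proof
    fix i show "a $ i \<le> a'' $ i \<and> a'' $ i + l'' \<le> a $ i + l"
      using sub[of i] l'l'' by (auto simp: a''_def)
  qed
  ultimately have "has_hole E (half_open_cube a'' l'') (\<kappa> ^ Suc m * r)"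
    unfolding \<kappa>_def using Suc.IH Suc.prems l''0 by blast
  moreover have "half_open_cube a' l' \<subseteq> half_open_cube a'' l''"
    unfolding half_open_cube_subset_iff[OF Suc.prems(2)]
  proof
    fix i show "a'' $ i \<le> a' $ i \<and> a' $ i + l' \<le> a'' $ i + l''"
      using sub[of i] l'l'' by (auto simp: a''_def)
  qed
  moreover have "0 < \<kappa> ^ Suc m * r" using \<kappa> Suc.prems by simp
  ultimately have "has_hole E (half_open_cube a' l') (\<kappa> * (\<kappa> ^ Suc m * r))"
    unfolding \<kappa>_def
    using has_hole_slightly_smaller_cube[OF fill \<theta> \<open>0 < \<delta>\<close> l''0 \<theta>l''] by blast
  then show ?case unfolding \<kappa>_def by (simp add: mult.assoc)
qed

text \<open>A child has half the side, so boundedly many shrinkings suffice. Since \<kappa> is fixed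
  before \<open>E\<close>, it depends only on \<sigma>, \<delta> and the dimension.\<close>

lemma has_hole_dyadic_child:
  assumes "0 < \<sigma>" "0 < \<delta>"
  obtains \<kappa> where "0 < \<kappa>" "\<kappa> \<le> 1"
    "\<And>(E :: (real ^ 'n) set) Q R r. hole_filling \<sigma> \<delta> E \<Longrightarrow> R \<in> dyadic_gen 1 Q \<Longrightarrow> 0 < r \<Longrightarrow> has_hole E Q r
      \<Longrightarrow> has_hole E R (\<kappa> * r)"
proof -
  let ?n = "CARD('n)"
  \<comment> \<open>By Bernoulli, \<open>(1 - \<epsilon>) ^ (2 * ?n)\<close> is at least
    \<open>1 - \<sigma> / 2\<close>; the cap \<open>1 / 2\<close> keeps \<theta> positive.\<close>
  define \<epsilon> where "\<epsilon> = min (\<sigma> / (4 * ?n)) (1 / 2)"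
  have \<epsilon>: "0 < \<epsilon>" "\<epsilon> \<le> 1 / 2" "\<epsilon> * (4 * ?n) \<le> \<sigma>"
  proof -
    show "0 < \<epsilon>" "\<epsilon> \<le> 1 / 2" using assms by (auto simp: \<epsilon>_def)
    have "\<epsilon> \<le> \<sigma> / (4 * ?n)" by (simp add: \<epsilon>_def)
    then show "\<epsilon> * (4 * ?n) \<le> \<sigma>" by (simp add: field_simps)
  qed
  define \<theta> where "\<theta> = 1 - \<epsilon>"
  have \<theta>: "0 < \<theta>" "\<theta> < 1" using \<epsilon> by (auto simp: \<theta>_def)
  have "1 - \<sigma> < 1 + real (2 * ?n) * (- \<epsilon>)" using \<epsilon> assms by (simp add: algebra_simps)
  also have "\<dots> \<le> (1 + (- \<epsilon>)) ^ (2 * ?n)" using \<epsilon> by (intro Bernoulli_inequality) auto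
  finally have \<theta>2: "1 - \<sigma> < \<theta> ^ (2 * ?n)" by (simp add: \<theta>_def)
  obtain m where m: "\<theta> ^ m < 1 / 2" using real_arch_pow_inv[of "1 / 2" \<theta>] \<theta> by auto
  have "\<theta> ^ Suc m \<le> 1 * \<theta> ^ m" unfolding power_Suc using \<theta> by (intro mult_right_mono) auto
  then have m': "\<theta> ^ Suc m \<le> 1 / 2" using m by linarith
  define \<kappa>1 where "\<kappa>1 = min \<delta> ((1 - \<theta>) * \<theta> / 2)"
  have \<kappa>1: "0 < \<kappa>1" "\<kappa>1 \<le> 1"
    using \<theta> \<open>0 < \<delta>\<close> mult_strict_mono[of "1 - \<theta>" 1 \<theta> 1] by (auto simp: \<kappa>1_def min_le_iff_disj)
  show thesis
  proof (rule that[of "\<kappa>1 ^ Suc m"])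
    show "0 < \<kappa>1 ^ Suc m" using \<kappa>1 by simp
    show "\<kappa>1 ^ Suc m \<le> 1" using \<kappa>1 by (intro power_le_one) auto
    fix E :: "(real ^ 'n) set" and Q R r
    assume fill: "hole_filling \<sigma> \<delta> E" and R: "R \<in> dyadic_gen 1 Q" and r: "0 < (r::real)" "has_hole E Q r"
    obtain a l where Q: "0 < l" "Q = half_open_cube a l" using R unfolding dyadic_gen_def by auto
    obtain a' where R': "R = half_open_cube a' (l / 2)"
      using R unfolding Q(2) dyadic_gen_half_open_cube[OF Q(1)] by auto
    show "has_hole E R (\<kappa>1 ^ Suc m * r)"
      unfolding R' \<kappa>1_def
    proof (rule has_hole_smaller_cube[OF fill \<theta> \<theta>2 \<open>0 < \<delta>\<close> Q(1)])
      show "0 < l / 2" using Q by simp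
      show "\<theta> ^ Suc m * l \<le> l / 2" using mult_right_mono[OF m', of l] Q by simp
      show "half_open_cube a' (l / 2) \<subseteq> half_open_cube a l"
        using dyadic_gen_subset[OF R] unfolding R' Q(2) .
    qed (use r Q in auto)
  qed
qed


section \<open>Geometric decay of the uncovered part\<close>

text \<open>A cube meeting \<open>E\<close> is not free itself, so each of its free dyadic subcubes
  lies in a child.\<close>

lemma free_union_children:
  assumes "is_cube Q" "Q \<inter> E \<noteq> {}"
  shows "free_union E Q c = (\<Union>R\<in>dyadic_gen 1 Q. free_union E R c)"
  using dyadic_split[OF assms(1)] assms(2) unfolding free_union_def by blast

text \<open>Children are disjoint, so the free cubes of one remove nothing from another. The
  uncovered measure thus becomes additive over children.\<close>

lemma Diff_free_union_children:
  assumes "is_cube Q" "Q \<inter> E \<noteq> {}"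
  shows "Q - free_union E Q c = (\<Union>R\<in>dyadic_gen 1 Q. R - free_union E R c)"
proof -
  have inj: "R = R'" if "x \<in> R" "x \<in> free_union E R' c" "R \<in> dyadic_gen 1 Q" "R' \<in> dyadic_gen 1 Q" for x R R'
    using dyadic_gen_disjoint[OF that(3,4)] that(1,2) free_union_subset by blast
  have "x \<in> Q - (\<Union>R\<in>dyadic_gen 1 Q. free_union E R c) \<longleftrightarrow> (\<exists>R\<in>dyadic_gen 1 Q. x \<in> R - free_union E R c)" for x
  proof -
    have "x \<in> Q \<longleftrightarrow> (\<exists>R\<in>dyadic_gen 1 Q. x \<in> R)"
      using dyadic_gen_Union[OF assms(1), of 1] by (metis Union_iff)
    then show ?thesis using inj[of x] by (simp only: Diff_iff UN_iff) metis
  qed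
  then show ?thesis unfolding free_union_children[OF assms] by (intro set_eqI) (simp only: UN_iff)
qed

lemma is_cube_lmeasurable: "is_cube (Q :: (real ^ 'n) set) \<Longrightarrow> Q \<in> lmeasurable"
  unfolding is_cube_def by auto

lemma Diff_free_union_lmeasurable:
  "is_cube (Q :: (real ^ 'n) set) \<Longrightarrow> Q - free_union E Q c \<in> lmeasurable"
  by (simp add: fmeasurable.Diff free_union_lmeasurable is_cube_lmeasurable)

lemma dyadic_side_le:
  assumes "R \<in> dyadic (Q :: (real ^ 'n) set)"
  shows "side_length R \<le> side_length Q"
proof -
  obtain a l where R: "R = half_open_cube a l" "0 < l"
    using dyadic_is_cube[OF assms] unfolding is_cube_def by auto
  obtain j where "R \<in> dyadic_gen j Q" using assms unfolding dyadic_def by auto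
  then obtain b m where Q: "Q = half_open_cube b m" "0 < m" unfolding dyadic_gen_def by auto
  show ?thesis using half_open_cube_subset_side_le[OF R(2), of a b m] dyadic_is_cube(2)[OF assms] R Q by simp
qed

text \<open>Induction on the generation replaces the stopping-time decomposition of the part of \<open>Q\<close> outside
  the holes of side at least \<open>b\<close>: a cube with no such hole is handled by \<open>small\<close>, and any other
  cube passes a hole of side \<open>\<kappa> * b\<close> on to each of its children.\<close>

lemma measure_Diff_free_union_scales:
  fixes E :: "(real ^ 'n) set"
  assumes child: "\<And>Q R r. R \<in> dyadic_gen 1 Q \<Longrightarrow> 0 < r \<Longrightarrow> has_hole E Q r \<Longrightarrow> has_hole E R (\<kappa> * r)"
    and b: "0 < b" "c \<le> b" and t: "0 \<le> t"
    and small: "\<And>Q. is_cube Q \<Longrightarrow> has_hole E Q (\<kappa> * b) \<Longrightarrow>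
      measure lebesgue (Q - free_union E Q c) \<le> t * measure lebesgue Q"
    and Q: "is_cube Q" "side_length Q < 2 ^ j * b" "has_hole E Q (\<kappa> * b)"
  shows "measure lebesgue (Q - free_union E Q c) \<le> t * measure lebesgue (Q - free_union E Q b)"
  using Q
proof (induction j arbitrary: Q)
  case 0
  \<comment> \<open>The side of \<open>Q\<close> is below \<open>b\<close>, so no dyadic subcube is
    large enough to be removed.\<close>
  have "free_union E Q b = {}"
    using dyadic_side_le[of _ Q] 0(2) unfolding free_union_def by fastforce
  then show ?case using small[OF 0(1,3)] by simp
next
  case (Suc j)
  consider "free_union E Q b = {}" | "Q \<inter> E = {}" "free_union E Q b \<noteq> {}"
    | "Q \<inter> E \<noteq> {}" "free_union E Q b \<noteq> {}" by blast
  then show ?case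
  proof cases
    case 1
    then show ?thesis using small[OF Suc.prems(1,3)] by simp
  next
    case 2
    \<comment> \<open>\<open>Q\<close> is free and large enough to cover itself, so nothing is left
      at threshold \<open>c\<close>.\<close>
    then have "c \<le> side_length Q"
      using dyadic_side_le[of _ Q] b unfolding free_union_def by fastforce
    then have "Q \<subseteq> free_union E Q c"
      using 2 dyadic_split[OF Suc.prems(1)] unfolding free_union_def by blast
    then have "Q - free_union E Q c = {}" by blast
    then show ?thesis using t by (simp only:) simp
  next
    case 3
    \<comment> \<open>A hole of side \<open>b\<close> in \<open>Q\<close> gives every child a hole
      of side \<open>\<kappa> * b\<close>, as the induction hypothesis requires.\<close>
    have "has_hole E Q b"
    proof -
      obtain x where "x \<in> free_union E Q b" using 3 by blast
      then obtain p \<rho> where "b \<le> \<rho>" "half_open_cube p \<rho> \<subseteq> Q - E" by (rule in_free_unionE)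
      then have "has_hole E Q \<rho>" unfolding has_hole_def by blast
      then show ?thesis using has_hole_mono b \<open>b \<le> \<rho>\<close> by blast
    qed
    then have IH: "measure lebesgue (R - free_union E R c) \<le> t * measure lebesgue (R - free_union E R b)"
      if "R \<in> dyadic_gen 1 Q" for R
      using Suc.IH[of R] child[OF that b(1)] dyadic_gen_side_length[OF that] Suc.prems(2) by simp
    have fin: "finite (dyadic_gen 1 Q)" by (rule finite_dyadic_gen[OF Suc.prems(1)])
    have meas: "R - free_union E R c' \<in> lmeasurable" if "R \<in> dyadic_gen 1 Q" for R c'
      by (rule Diff_free_union_lmeasurable[OF dyadic_gen_side_length(1)[OF that]])
    have eq: "measure lebesgue (Q - free_union E Q c') =
        (\<Sum>R\<in>dyadic_gen 1 Q. measure lebesgue (R - free_union E R c'))" for c'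
      unfolding Diff_free_union_children[OF Suc.prems(1) 3(1)]
    proof (rule measure_UNION'[OF fin meas])
      show "pairwise (\<lambda>i j. disjnt (i - free_union E i c') (j - free_union E j c')) (dyadic_gen 1 Q)"
        using dyadic_gen_disjoint[of _ 1 Q] unfolding pairwise_def disjnt_def by blast
    qed
    show ?thesis unfolding eq sum_distrib_left by (intro sum_mono IH)
  qed
qed

text \<open>Each round costs a factor \<delta> in the threshold for filling and \<kappa> for passing
  to children, and gains \<open>1 - \<sigma>\<close> in measure. The induction ranges over all cubes
  and hole sizes, since later rounds take place in subcubes.\<close>

lemma measure_Diff_free_union_power:
  fixes E :: "(real ^ 'n) set"
  assumes fill: "hole_filling \<sigma> \<delta> E" and "\<sigma> < 1"
    and \<delta>: "0 < \<delta>" "\<delta> \<le> 1" and \<kappa>: "0 < \<kappa>" "\<kappa> \<le> 1"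
    and child: "\<And>Q R r. R \<in> dyadic_gen 1 Q \<Longrightarrow> 0 < r \<Longrightarrow> has_hole E Q r \<Longrightarrow> has_hole E R (\<kappa> * r)"
    and "is_cube Q" "0 < r" "has_hole E Q r"
  shows "measure lebesgue (Q - free_union E Q ((\<kappa> * \<delta>) ^ m * r)) \<le> (1 - \<sigma>) ^ m * measure lebesgue Q"
  using assms(8-)
proof (induction m arbitrary: Q r)
  case 0
  then show ?case
    by (auto intro!: measure_mono_fmeasurable simp: is_cube_lmeasurable fmeasurableD[OF Diff_free_union_lmeasurable])
next
  case (Suc m)
  define b where "b = \<delta> * r"
  have b: "0 < b" "b \<le> r" using \<delta> Suc.prems by (simp_all add: b_def mult_left_le_one_le)
  have \<kappa>b: "0 < \<kappa> * b" "\<kappa> * b \<le> b" using \<kappa> b by (simp_all add: mult_left_le_one_le)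
  have c: "(\<kappa> * \<delta>) ^ Suc m * r = (\<kappa> * \<delta>) ^ m * (\<kappa> * b)" by (simp add: b_def)
  have "(\<kappa> * \<delta>) ^ m \<le> 1" using \<kappa> \<delta> by (intro power_le_one) (auto simp: mult_le_one)
  then have "(\<kappa> * \<delta>) ^ m * (\<kappa> * b) \<le> 1 * (\<kappa> * b)" using \<kappa>b by (intro mult_right_mono) auto
  then have cb: "(\<kappa> * \<delta>) ^ m * (\<kappa> * b) \<le> b" using \<kappa>b by linarith
  obtain j where "side_length Q / b < 2 ^ j" using real_arch_pow[of 2] by auto
  then have j: "side_length Q < 2 ^ j * b" using b by (simp add: field_simps)
  have hole: "has_hole E Q (\<kappa> * b)" by (rule has_hole_mono[OF Suc.prems(3)]) (use b \<kappa>b in auto)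
  \<comment> \<open>The induction hypothesis for hole size \<open>\<kappa> * b\<close> serves as the
    estimate on every cube having such a hole.\<close>
  have "measure lebesgue (Q - free_union E Q ((\<kappa> * \<delta>) ^ m * (\<kappa> * b)))
      \<le> (1 - \<sigma>) ^ m * measure lebesgue (Q - free_union E Q b)"
    by (rule measure_Diff_free_union_scales[OF child b(1) cb _ _ Suc.prems(1) j hole])
      (use \<open>\<sigma> < 1\<close> Suc.IH \<kappa>b in auto)
  also have "measure lebesgue (Q - free_union E Q b) \<le> (1 - \<sigma>) * measure lebesgue Q"
  proof -
    obtain a l where Q: "0 < l" "Q = half_open_cube a l" using Suc.prems(1) unfolding is_cube_def by auto
    have "\<sigma> * measure lebesgue Q \<le> measure lebesgue (free_union E Q b)"
      using fill Q Suc.prems measure_half_open_cube[OF Q(1), of a] unfolding hole_filling_def b_def by simp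
    moreover have "measure lebesgue (Q - free_union E Q b) = measure lebesgue Q - measure lebesgue (free_union E Q b)"
      using free_union_lmeasurable[OF Suc.prems(1)] free_union_subset is_cube_lmeasurable[OF Suc.prems(1)]
      by (intro measurable_measure_Diff fmeasurableD) blast+
    ultimately show ?thesis by (simp add: algebra_simps)
  qed
  finally show ?case using \<open>\<sigma> < 1\<close> unfolding c by (simp add: mult_left_mono mult_ac)
qed

section \<open>Weak porosity as hole filling\<close>

text \<open>Sides decrease with the generation, so a free cube of the first generation containing
  one is maximal; \<open>R\<close> shows that such a generation exists.\<close>

lemma max_free_cube:
  fixes E :: "(real ^ 'n) set"
  assumes "R \<in> dyadic Q" "R \<inter> closure E = {}"
  shows "max_free_cube E Q \<in> dyadic Q" "max_free_cube E Q \<inter> closure E = {}"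
    "side_length R \<le> side_length (max_free_cube E Q)"
proof -
  let ?P = "\<lambda>j. \<exists>R\<in>dyadic_gen j Q. R \<inter> closure E = {}"
  let ?free = "\<lambda>R. R \<in> dyadic Q \<and> R \<inter> closure E = {}"
  define j where "j = (LEAST j. ?P j)"
  have "\<exists>j. ?P j" using assms unfolding dyadic_def by blast
  then have "?P j" unfolding j_def by (rule LeastI_ex)
  then obtain R0 where R0: "R0 \<in> dyadic_gen j Q" "R0 \<inter> closure E = {}" by blast
  have max: "\<not> side_length R0 < side_length S" if S: "?free S" for S
  proof -
    obtain i where i: "S \<in> dyadic_gen i Q" using S unfolding dyadic_def by blast
    then have "j \<le> i" unfolding j_def using S by (blast intro: Least_le)
    moreover have "0 < side_length Q" using i unfolding dyadic_gen_def by auto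
    ultimately have "side_length Q / 2 ^ i \<le> side_length Q / 2 ^ j"
      by (intro divide_left_mono power_increasing) auto
    then show ?thesis
      using dyadic_gen_side_length(2)[OF i] dyadic_gen_side_length(2)[OF R0(1)] by simp
  qed
  have "?free (max_free_cube E Q) \<and> side_length R \<le> side_length (max_free_cube E Q)"
    unfolding max_free_cube_def
    by (rule arg_maxI[of ?free R0]) (use R0 max assms in \<open>force simp: dyadic_def not_less\<close>)+
  then show "max_free_cube E Q \<in> dyadic Q" "max_free_cube E Q \<inter> closure E = {}"
    "side_length R \<le> side_length (max_free_cube E Q)" by auto
qed

text \<open>A hole of side \<open>r\<close> contains a free dyadic cube of side at least
  \<open>r / 4\<close>, so the maximal free cube is at least that large; hence the constant
  \<open>\<gamma> / 4\<close>. All cubes supplied by weak porosity then lie in the covered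
  set.\<close>

lemma weakly_porous_hole_filling:
  fixes E :: "(real ^ 'n) set"
  assumes "weakly_porous \<sigma> \<gamma> E" "closed E"
  shows "hole_filling \<sigma> (\<gamma> / 4) E"
  unfolding hole_filling_def
proof (intro allI impI)
  fix a :: "real ^ 'n" and l r :: real
  let ?Q = "half_open_cube a l"
  assume "0 < l" "0 < r" "has_hole E ?Q r"
  have Q: "is_cube ?Q" using \<open>0 < l\<close> unfolding is_cube_def by blast
  have cl: "closure E = E" using assms(2) by simp
  have "0 < \<gamma>" using assms(1) unfolding weakly_porous_def by blast
  obtain b where b: "half_open_cube b r \<subseteq> ?Q - E"
    using \<open>has_hole E ?Q r\<close> unfolding has_hole_def by blast
  then have "half_open_cube b r \<subseteq> ?Q" by blast
  then obtain R where R: "R \<in> dyadic ?Q" "R \<subseteq> half_open_cube b r" "r / 4 \<le> side_length R"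
    by (rule exists_dyadic_subcube[OF \<open>0 < l\<close> \<open>0 < r\<close>])
  have "R \<inter> closure E = {}" using R(2) b cl by blast
  then have "r / 4 \<le> side_length (max_free_cube E ?Q)"
    using max_free_cube(3)[OF R(1)] R(3) by fastforce
  then have big: "\<gamma> / 4 * r \<le> \<gamma> * side_length (max_free_cube E ?Q)"
    using \<open>0 < \<gamma>\<close> mult_left_mono[of "r / 4" _ \<gamma>] by simp
  obtain N :: nat and Qs where Qs:
    "\<And>i. i \<in> {1..N} \<Longrightarrow> Qs i \<in> dyadic ?Q \<and> Qs i \<subseteq> ?Q - closure E \<and>
       \<gamma> * side_length (max_free_cube E ?Q) \<le> side_length (Qs i)"
    "disjoint_family_on Qs {1..N}"
    "\<sigma> * measure lebesgue ?Q \<le> (\<Sum>i=1..N. measure lebesgue (Qs i))"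
    using assms(1) Q unfolding weakly_porous_def by meson
  have meas: "Qs i \<in> lmeasurable" if "i \<in> {1..N}" for i
    using Qs(1)[OF that] dyadic_is_cube(1) is_cube_lmeasurable by blast
  have "\<sigma> * l ^ CARD('n) \<le> (\<Sum>i=1..N. measure lebesgue (Qs i))"
    using Qs(3) measure_half_open_cube[OF \<open>0 < l\<close>, of a] by simp
  also have "\<dots> = measure lebesgue (\<Union>i\<in>{1..N}. Qs i)"
    using Qs(2) meas
    by (intro measure_UNION'[symmetric]) (auto simp: disjoint_family_on_def pairwise_def disjnt_def)
  also have "\<dots> \<le> measure lebesgue (free_union E ?Q (\<gamma> / 4 * r))"
  proof (rule measure_mono_fmeasurable)
    show "(\<Union>i\<in>{1..N}. Qs i) \<subseteq> free_union E ?Q (\<gamma> / 4 * r)"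
      using Qs(1) big unfolding cl free_union_def by fastforce
    show "(\<Union>i\<in>{1..N}. Qs i) \<in> sets lebesgue" using meas by (intro sets.finite_UN) auto
  qed (rule free_union_lmeasurable[OF Q])
  finally show "\<sigma> * l ^ CARD('n) \<le> measure lebesgue (free_union E ?Q (\<gamma> / 4 * r))" .
qed

text \<open>With \<open>N = 0\<close> the selected mass would be 0, against
  \<open>0 < \<sigma>\<close>.\<close>

lemma weakly_porous_free_cube:
  fixes E :: "(real ^ 'n) set"
  assumes "weakly_porous \<sigma> \<gamma> E" "is_cube Q"
  obtains R where "R \<in> dyadic Q" "R \<inter> closure E = {}"
proof -
  obtain N :: nat and Qs where Qs:
    "\<And>i. i \<in> {1..N} \<Longrightarrow> Qs i \<in> dyadic Q \<and> Qs i \<subseteq> Q - closure E"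
    "\<sigma> * measure lebesgue Q \<le> (\<Sum>i=1..N. measure lebesgue (Qs i))"
    using assms unfolding weakly_porous_def by meson
  have "0 < \<sigma> * measure lebesgue Q"
    using assms(1) measure_cube_pos[OF assms(2)] unfolding weakly_porous_def by simp
  then have "N \<noteq> 0" using Qs(2) by (intro notI) simp
  then show thesis using Qs(1)[of 1] that[of "Qs 1"] by fastforce
qed


section \<open>Maximal free cubes and their mass\<close>

lemma dyadic_freeD:
  assumes "R \<in> dyadic_free E (Q :: (real ^ 'n) set)"
  shows "R \<in> dyadic Q" "R \<inter> closure E = {}"
  using assms unfolding dyadic_free_def dyadic_def by auto

text \<open>If two such cubes of different generations met, the parent of the smaller one would lie
  in the larger one and so be free.\<close>

lemma dyadic_free_disjoint:
  assumes R: "R \<in> dyadic_free E Q" and S: "S \<in> dyadic_free E Q" and ne: "R \<inter> S \<noteq> {}"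
  shows "R = S"
proof -
  have aux: "R' = S'"
    if R: "R' \<in> dyadic_free E Q" and S: "S' \<in> dyadic_free E Q" and ne: "R' \<inter> S' \<noteq> {}"
      and i: "R' \<in> dyadic_gen i Q" and j: "S' \<in> dyadic_gen j Q" and "i \<le> j" for R' S' i j
  proof (rule ccontr)
    assume neq: "R' \<noteq> S'"
    have Q: "is_cube Q" using i unfolding dyadic_gen_def is_cube_def by auto
    have "i \<noteq> j" using dyadic_gen_disjoint[OF i _ ne] j neq by auto
    \<comment> \<open>The parent of \<open>S'\<close> has generation \<open>i + k\<close>, still no
      coarser than \<open>R'\<close>.\<close>
    then obtain k where k: "j = Suc (i + k)" using \<open>i \<le> j\<close> less_imp_Suc_add[of i j] by auto
    let ?P = "dyadic_parent Q S'"
    have P: "?P \<in> dyadic_gen (i + k) Q" "S' \<subseteq> ?P" using dyadic_parent_unique(2,3)[OF j[unfolded k]] by auto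
    then have "?P \<in> dyadic_gen k R'" using dyadic_nested[OF Q i] ne by blast
    then have "?P \<subseteq> R'" by (rule dyadic_gen_subset)
    then show False using R S unfolding dyadic_free_def by blast
  qed
  obtain i j where "R \<in> dyadic_gen i Q" "S \<in> dyadic_gen j Q"
    using R S unfolding dyadic_free_def by auto
  then show ?thesis using aux[OF R S ne] aux[OF S R] ne by (metis Int_commute le_cases)
qed

text \<open>Climbing from \<open>R\<close> through its ancestors must stop at a free cube whose
  parent meets \<open>E\<close>, because \<open>Q\<close> itself meets \<open>E\<close>.\<close>

lemma free_subset_dyadic_free:
  assumes "closed E" "is_cube Q" "Q \<inter> E \<noteq> {}" "R \<in> dyadic_gen j Q" "R \<inter> E = {}"
  obtains S where "S \<in> dyadic_free E Q" "R \<subseteq> S" "side_length R \<le> side_length S"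
  using assms(4,5)
proof (induction j arbitrary: R thesis)
  case 0
  then show ?case using dyadic_gen_0[OF assms(2)] assms(3) by auto
next
  case (Suc j)
  let ?P = "dyadic_parent Q R"
  have P: "?P \<in> dyadic_gen j Q" "R \<subseteq> ?P" using dyadic_parent_unique[OF Suc.prems(2)] by auto
  show ?case
  proof (cases "?P \<inter> E = {}")
    case True
    obtain S where S: "S \<in> dyadic_free E Q" "?P \<subseteq> S" "side_length ?P \<le> side_length S"
      using Suc.IH[OF _ P(1) True] by blast
    have "R \<inter> ?P \<noteq> {}"
    proof -
      obtain a l where "0 < l" "R = half_open_cube a l"
        using dyadic_gen_side_length(1)[OF Suc.prems(2)] unfolding is_cube_def by auto
      then have "a \<in> R" by (simp add: half_open_cube_def)
      then show ?thesis using P by blast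
    qed
    then have "R \<in> dyadic_gen 1 ?P"
      using dyadic_nested[OF assms(2) P(1), of R 1] Suc.prems(2) by auto
    then have "side_length R \<le> side_length ?P"
      by (intro dyadic_side_le) (auto simp: dyadic_def)
    then show ?thesis using Suc.prems(1)[OF S(1)] S P(2) by auto
  next
    case False
    then have "R \<in> dyadic_free E Q"
      using Suc.prems assms(1) unfolding dyadic_free_def by auto
    then show ?thesis using Suc.prems(1) by blast
  qed
qed

text \<open>Links the set in the decay estimate to the cubes that define the scales. Passing to the
  maximal free cube around a given one only increases the side, so the threshold is kept.\<close>

lemma free_union_eq_dyadic_free:
  assumes "closed E" "is_cube Q" "Q \<inter> E \<noteq> {}"
  shows "free_union E Q c = \<Union>{R \<in> dyadic_free E Q. c \<le> side_length R}"
proof (intro equalityI subsetI)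
  fix x assume "x \<in> free_union E Q c"
  then obtain R j where R: "R \<in> dyadic_gen j Q" "R \<inter> E = {}" "c \<le> side_length R" "x \<in> R"
    unfolding free_union_def dyadic_def by auto
  obtain S where "S \<in> dyadic_free E Q" "R \<subseteq> S" "side_length R \<le> side_length S"
    using free_subset_dyadic_free[OF assms R(1,2)] by blast
  then show "x \<in> \<Union>{R \<in> dyadic_free E Q. c \<le> side_length R}" using R by auto
next
  fix x assume "x \<in> \<Union>{R \<in> dyadic_free E Q. c \<le> side_length R}"
  then show "x \<in> free_union E Q c"
    using dyadic_freeD[of _ E Q] assms(1) unfolding free_union_def by auto
qed

lemma dyadic_side_length:
  assumes "R \<in> dyadic Q"
  obtains i where "side_length R = side_length Q / 2 ^ i"
  using assms dyadic_gen_side_length(2) unfolding dyadic_def by blast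

lemma finite_dyadic_large:
  assumes "is_cube (Q :: (real ^ 'n) set)" "0 < c"
  shows "finite {R \<in> dyadic Q. c \<le> side_length R}"
proof -
  obtain J where J: "side_length Q / c < 2 ^ J" using real_arch_pow[of 2] by auto
  have "{R \<in> dyadic Q. c \<le> side_length R} \<subseteq> (\<Union>j\<in>{..J}. dyadic_gen j Q)"
  proof
    fix R assume "R \<in> {R \<in> dyadic Q. c \<le> side_length R}"
    then obtain j where R: "R \<in> dyadic_gen j Q" "c \<le> side_length R"
      unfolding dyadic_def by blast
    then have j: "R \<in> dyadic_gen j Q" "c \<le> side_length Q / 2 ^ j"
      using dyadic_gen_side_length(2) by metis+
    then have "2 ^ j \<le> side_length Q / c" using assms(2) by (simp add: field_simps)
    then have "(2::real) ^ j < 2 ^ J" using J by linarith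
    then have "j \<le> J" by simp
    then show "R \<in> (\<Union>j\<in>{..J}. dyadic_gen j Q)" using j by blast
  qed
  then show ?thesis using finite_dyadic_gen[OF assms(1)] by (meson finite_UN_I finite_atMost finite_subset)
qed

lemma measure_Union_dyadic_free:
  fixes Q :: "(real ^ 'n) set"
  assumes "F \<subseteq> dyadic_free E Q" "finite F"
  shows "measure lebesgue (\<Union>F) = (\<Sum>R\<in>F. measure lebesgue R)"
proof -
  have "measure lebesgue (\<Union>R\<in>F. R) = (\<Sum>R\<in>F. measure lebesgue R)"
  proof (rule measure_UNION'[OF assms(2)])
    show "R \<in> lmeasurable" if "R \<in> F" for R
      using that assms(1) dyadic_freeD(1) dyadic_is_cube(1) is_cube_lmeasurable by blast
    show "pairwise (\<lambda>i j. disjnt i j) F"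
      using assms(1) dyadic_free_disjoint unfolding pairwise_def disjnt_def by blast
  qed
  then show ?thesis by simp
qed

lemma dyadic_free_mass_le:
  fixes Q :: "(real ^ 'n) set"
  assumes "is_cube Q" "F \<subseteq> dyadic_free E Q" "finite F"
  shows "(\<Sum>R\<in>F. measure lebesgue R / measure lebesgue Q) \<le> 1"
proof -
  have pos: "0 < measure lebesgue Q" by (rule measure_cube_pos[OF assms(1)])
  have cubes: "R \<subseteq> Q \<and> R \<in> sets lebesgue" if "R \<in> F" for R
    using that assms(2) dyadic_freeD(1) dyadic_is_cube is_cube_lmeasurable by (metis fmeasurableD subsetD)
  have "measure lebesgue (\<Union>F) \<le> measure lebesgue Q"
    using cubes assms(3) by (intro measure_mono_fmeasurable is_cube_lmeasurable assms(1) sets.finite_Union) auto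
  then show ?thesis
    using pos unfolding measure_Union_dyadic_free[OF assms(2,3)] by (simp add: sum_divide_distrib[symmetric])
qed

text \<open>Finite partial sums are at most 1. This has to be recorded because \<open>infsum\<close>
  is 0 on families that are not summable.\<close>

lemma dyadic_free_mass_summable:
  fixes Q :: "(real ^ 'n) set"
  assumes "is_cube Q" "A \<subseteq> dyadic_free E Q"
  shows "(\<lambda>R. measure lebesgue R / measure lebesgue Q) summable_on A"
proof (rule nonneg_bdd_above_summable_on)
  show "bdd_above (sum (\<lambda>R. measure lebesgue R / measure lebesgue Q) ` {F. F \<subseteq> A \<and> finite F})"
    using dyadic_free_mass_le[OF assms(1)] assms(2) by (intro bdd_aboveI2[where M = 1]) blast
qed simp

text \<open>Serves to turn a mass above \<open>1 - s\<close> of large cubes into a mass below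
  \<open>s\<close> of smaller ones.\<close>

lemma dyadic_free_disjoint_mass_le:
  fixes Q :: "(real ^ 'n) set"
  assumes "is_cube Q" "A \<subseteq> dyadic_free E Q" "B \<subseteq> dyadic_free E Q" "A \<inter> B = {}"
  shows "(\<Sum>\<^sub>\<infinity>R\<in>A. measure lebesgue R / measure lebesgue Q) +
    (\<Sum>\<^sub>\<infinity>R\<in>B. measure lebesgue R / measure lebesgue Q) \<le> 1"
proof -
  let ?w = "\<lambda>R. measure lebesgue R / measure lebesgue Q"
  have "infsum ?w (A \<union> B) = infsum ?w A + infsum ?w B"
    using assms by (intro infsum_Un_disjoint dyadic_free_mass_summable) auto
  moreover have "infsum ?w (A \<union> B) \<le> 1"
  proof (rule infsum_le_finite_sums)
    show "?w summable_on (A \<union> B)" using assms by (intro dyadic_free_mass_summable) auto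
    show "sum ?w F \<le> 1" if "finite F" "F \<subseteq> A \<union> B" for F
      using dyadic_free_mass_le[OF assms(1) _ that(1)] that(2) assms(2,3) by blast
  qed
  ultimately show ?thesis by simp
qed

text \<open>Only finitely many cubes reach a positive threshold, so the infinite sum is a finite one
  over disjoint cubes.\<close>

lemma dyadic_free_large_mass:
  fixes Q :: "(real ^ 'n) set"
  assumes "closed E" "is_cube Q" "Q \<inter> E \<noteq> {}" "0 < c"
  shows "(\<Sum>\<^sub>\<infinity>R\<in>{R \<in> dyadic_free E Q. c \<le> side_length R}. measure lebesgue R / measure lebesgue Q) =
    measure lebesgue (free_union E Q c) / measure lebesgue Q"
proof -
  have "finite {R \<in> dyadic_free E Q. c \<le> side_length R}"
    by (rule finite_subset[OF _ finite_dyadic_large[OF assms(2,4)]]) (auto dest: dyadic_freeD)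
  then show ?thesis
    using measure_Union_dyadic_free[of "{R \<in> dyadic_free E Q. c \<le> side_length R}" E Q]
    unfolding free_union_eq_dyadic_free[OF assms(1-3)] by (auto simp: sum_divide_distrib)
qed

section \<open>Attainment of the two scales\<close>

lemma exists_scale_below:
  assumes "0 < (L::real)"
  obtains j where "l / 2 ^ j \<le> L" "\<And>i. l / 2 ^ i \<le> L \<Longrightarrow> j \<le> i"
proof -
  obtain j where "l / L < 2 ^ j" using real_arch_pow[of 2] by auto
  then have "l / 2 ^ j \<le> L" using assms by (simp add: field_simps)
  then show thesis
    using that[of "LEAST j. l / 2 ^ j \<le> L"] LeastI[of "\<lambda>j. l / 2 ^ j \<le> L" j]
      Least_le[of "\<lambda>j. l / 2 ^ j \<le> L"] by blast
qed

text \<open>Generation 0 is a candidate since \<open>L \<le> l\<close>, and \<open>0 < L\<close>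
  bounds the candidates, so a greatest one exists.\<close>

lemma exists_scale_above:
  assumes "0 < (L::real)" "L \<le> l"
  obtains j where "L \<le> l / 2 ^ j" "\<And>i. L \<le> l / 2 ^ i \<Longrightarrow> i \<le> j"
proof -
  let ?P = "\<lambda>j. L \<le> l / 2 ^ j"
  obtain J where J: "l / L < 2 ^ J" using real_arch_pow[of 2] by auto
  have bd: "i \<le> J" if "?P i" for i
  proof -
    have "2 ^ i \<le> l / L" using that assms by (simp add: field_simps)
    then have "(2::real) ^ i < 2 ^ J" using J by linarith
    then show ?thesis by simp
  qed
  have 0: "?P 0" using assms by simp
  show thesis
    using that[of "GREATEST j. ?P j"] GreatestI_nat[of ?P, OF 0 bd] Greatest_le_nat[of ?P _ J] bd by blast
qed

lemma scale_antimono: "0 < (l::real) \<Longrightarrow> i \<le> j \<Longrightarrow> l / 2 ^ j \<le> l / 2 ^ i"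
  by (intro divide_left_mono power_increasing) auto

text \<open>The sums defining the two scales only change at dyadic lengths, so their extremal
  thresholds are attained.\<close>

lemma large_scale_attained:
  fixes Q :: "(real ^ 'n) set"
  assumes "is_cube Q" "0 < t" "0 < c"
    and "t \<le> (\<Sum>\<^sub>\<infinity>R\<in>{R \<in> dyadic_free E Q. c \<le> side_length R}. measure lebesgue R / measure lebesgue Q)"
  obtains R where "R \<in> dyadic_free E Q" "large_scale E Q t \<le> side_length R"
proof -
  let ?f = "\<lambda>L. \<Sum>\<^sub>\<infinity>R\<in>{R \<in> dyadic_free E Q. L \<le> side_length R}. measure lebesgue R / measure lebesgue Q"
  let ?l = "side_length Q"
  have l: "0 < ?l" using assms(1) unfolding is_cube_def by auto
  have nonempty: "\<exists>R\<in>dyadic_free E Q. L \<le> side_length R" if "t \<le> ?f L" for L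
  proof (rule ccontr)
    assume "\<not> (\<exists>R\<in>dyadic_free E Q. L \<le> side_length R)"
    then have "{R \<in> dyadic_free E Q. L \<le> side_length R} = {}" by blast
    then show False using that \<open>0 < t\<close> by (simp only: infsum_empty)
  qed
  \<comment> \<open>No side lies strictly between \<open>L\<close> and the next length
    \<open>?l / 2 ^ j\<close> above it, so rounding \<open>L\<close> up leaves the family
    unchanged.\<close>
  have snap: "\<exists>j. L \<le> ?l / 2 ^ j \<and> t \<le> ?f (?l / 2 ^ j)" if L: "0 < L" "t \<le> ?f L" for L
  proof -
    obtain R where "R \<in> dyadic_free E Q" "L \<le> side_length R" using nonempty[OF L(2)] by blast
    then have "L \<le> ?l" using dyadic_side_le[OF dyadic_freeD(1)] by fastforce
    then obtain j where j: "L \<le> ?l / 2 ^ j" "\<And>i. L \<le> ?l / 2 ^ i \<Longrightarrow> i \<le> j"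
      using exists_scale_above[OF L(1)] by blast
    have "L \<le> side_length R \<longleftrightarrow> ?l / 2 ^ j \<le> side_length R" if R: "R \<in> dyadic_free E Q" for R
    proof -
      obtain i where "side_length R = ?l / 2 ^ i" using dyadic_side_length dyadic_freeD(1)[OF R] by blast
      then show ?thesis using j scale_antimono[OF l] by fastforce
    qed
    then have "{R \<in> dyadic_free E Q. L \<le> side_length R} = {R \<in> dyadic_free E Q. ?l / 2 ^ j \<le> side_length R}"
      by blast
    then show ?thesis using j(1) L(2) by (metis (no_types, lifting))
  qed
  define j where "j = (LEAST j. t \<le> ?f (?l / 2 ^ j))"
  have "\<exists>j. t \<le> ?f (?l / 2 ^ j)" using snap[OF assms(3,4)] by blast
  then have j: "t \<le> ?f (?l / 2 ^ j)" unfolding j_def by (rule LeastI_ex)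
  have "large_scale E Q t = ?l / 2 ^ j"
    unfolding large_scale_def
  proof (rule Greatest_equality)
    show "0 \<le> ?l / 2 ^ j \<and> t \<le> ?f (?l / 2 ^ j)" using j l by simp
    fix L assume L: "0 \<le> L \<and> t \<le> ?f L"
    \<comment> \<open>Rounding up needs a positive \<open>L\<close>; for \<open>L = 0\<close> the
      bound is trivial.\<close>
    show "L \<le> ?l / 2 ^ j"
    proof (cases "L = 0")
      case False
      then obtain i where i: "L \<le> ?l / 2 ^ i" "t \<le> ?f (?l / 2 ^ i)" using snap[of L] L by auto
      have "j \<le> i" unfolding j_def by (rule Least_le) (rule i(2))
      then show ?thesis using i(1) scale_antimono[OF l] by (meson order_trans)
    qed (use l in simp)
  qed
  then show thesis using nonempty[OF j] that by metis
qed

lemma small_scale_attained: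
  fixes Q :: "(real ^ 'n) set"
  assumes "is_cube Q"
    and "t \<le> (\<Sum>\<^sub>\<infinity>R\<in>dyadic_free E Q. measure lebesgue R / measure lebesgue Q)"
    and "0 < c"
    and low: "\<And>L. t \<le> (\<Sum>\<^sub>\<infinity>R\<in>{R \<in> dyadic_free E Q. side_length R \<le> L}. measure lebesgue R / measure lebesgue Q)
      \<Longrightarrow> c \<le> L"
  shows "c \<le> small_scale E Q t"
proof -
  let ?g = "\<lambda>L. \<Sum>\<^sub>\<infinity>R\<in>{R \<in> dyadic_free E Q. side_length R \<le> L}. measure lebesgue R / measure lebesgue Q"
  let ?l = "side_length Q"
  have l: "0 < ?l" using assms(1) unfolding is_cube_def by auto
  \<comment> \<open>Here \<open>L\<close> is rounded down, which needs \<open>0 < L\<close>; this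
    follows from \<open>low\<close>.\<close>
  have snap: "\<exists>j. ?l / 2 ^ j \<le> L \<and> t \<le> ?g (?l / 2 ^ j)" if L: "t \<le> ?g L" for L
  proof -
    have "0 < L" using low[OF L] \<open>0 < c\<close> by linarith
    then obtain j where j: "?l / 2 ^ j \<le> L" "\<And>i. ?l / 2 ^ i \<le> L \<Longrightarrow> j \<le> i"
      using exists_scale_below by blast
    have "side_length R \<le> L \<longleftrightarrow> side_length R \<le> ?l / 2 ^ j" if R: "R \<in> dyadic_free E Q" for R
    proof -
      obtain i where "side_length R = ?l / 2 ^ i" using dyadic_side_length dyadic_freeD(1)[OF R] by blast
      then show ?thesis using j scale_antimono[OF l] by fastforce
    qed
    then have "{R \<in> dyadic_free E Q. side_length R \<le> L} = {R \<in> dyadic_free E Q. side_length R \<le> ?l / 2 ^ j}"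
      by blast
    then show ?thesis using j(1) L by (metis (no_types, lifting))
  qed
  let ?P = "\<lambda>j. t \<le> ?g (?l / 2 ^ j)"
  have "{R \<in> dyadic_free E Q. side_length R \<le> ?l} = dyadic_free E Q"
    using dyadic_side_le dyadic_freeD(1) by blast
  then have P0: "?P 0" using assms(2) by simp
  then have "c \<le> ?l" using low[of ?l] by simp
  \<comment> \<open>By \<open>low\<close> no admissible length is below \<open>c\<close>, so the
    exponents are bounded; the greatest one gives the least length.\<close>
  then obtain J where J: "\<And>i. c \<le> ?l / 2 ^ i \<Longrightarrow> i \<le> J"
    using exists_scale_above[OF \<open>0 < c\<close>] by blast
  have bd: "i \<le> J" if "?P i" for i using J low[OF that] .
  define j where "j = (GREATEST j. ?P j)"
  have j: "?P j" unfolding j_def using GreatestI_nat[of ?P, OF P0 bd] .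
  have "small_scale E Q t = ?l / 2 ^ j"
    unfolding small_scale_def
  proof (rule Least_equality)
    show "0 \<le> ?l / 2 ^ j \<and> ?P j" using j l by simp
    fix L assume "0 \<le> L \<and> t \<le> ?g L"
    then obtain i where i: "?l / 2 ^ i \<le> L" "?P i" using snap[of L] by blast
    have "i \<le> j" unfolding j_def using Greatest_le_nat[of ?P, OF i(2) bd] .
    then show "?l / 2 ^ j \<le> L" using i(1) scale_antimono[OF l] by (meson order_trans)
  qed
  then show ?thesis using low[OF j] by simp
qed

section \<open>Comparison of the two scales\<close>

theorem theorem6p6:
  fixes \<sigma> \<gamma> s :: real
  assumes "0 < \<sigma>" "\<sigma> < 1" "0 < \<gamma>" "\<gamma> < 1"
    and "0 < s" "s < 1 / (1 + 2 ^ CARD('n::finite))"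
  shows "\<exists>C0>0. \<forall>E :: (real ^ 'n) set. closed E \<longrightarrow> weakly_porous \<sigma> \<gamma> E \<longrightarrow>
    (\<forall>Q0. is_cube Q0 \<longrightarrow> Q0 \<inter> E \<noteq> {} \<longrightarrow>
       large_scale E Q0 s \<le> C0 * small_scale E Q0 s)"
proof -
  \<comment> \<open>Leads to \<open>s < 1 - s\<close>: a mass above \<open>1 - s\<close> also
    exceeds \<open>s\<close>, so both scales are attained at level \<open>s\<close>.\<close>
  have "(1::real) \<le> 2 ^ CARD('n)" by simp
  then have "1 / (1 + 2 ^ CARD('n)) \<le> (1 / 2 :: real)" by (intro frac_le) auto
  then have s: "s < 1 / 2" using assms(6) by linarith
  define \<delta> where "\<delta> = \<gamma> / 4"
  have \<delta>: "0 < \<delta>" "\<delta> \<le> 1" using assms by (auto simp: \<delta>_def)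
  obtain \<kappa> where \<kappa>: "0 < \<kappa>" "\<kappa> \<le> 1"
    and child: "\<And>(E :: (real ^ 'n) set) Q R r. hole_filling \<sigma> \<delta> E \<Longrightarrow> R \<in> dyadic_gen 1 Q \<Longrightarrow> 0 < r \<Longrightarrow>
      has_hole E Q r \<Longrightarrow> has_hole E R (\<kappa> * r)"
    using has_hole_dyadic_child[OF assms(1) \<delta>(1)] by metis
  \<comment> \<open>After \<open>m\<close> rounds less than the proportion \<open>s\<close> is
    uncovered. Both \<open>m\<close> and \<open>c\<close> are fixed before \<open>E\<close> and the
    cube, which makes \<open>1 / c\<close> uniform.\<close>
  obtain m where m: "(1 - \<sigma>) ^ m < s" using real_arch_pow_inv[of s "1 - \<sigma>"] assms by auto
  define c where "c = (\<kappa> * \<delta>) ^ m"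
  have c: "0 < c" using \<kappa> \<delta> by (simp add: c_def)
  have "large_scale E Q s \<le> 1 / c * small_scale E Q s"
    if E: "closed E" "weakly_porous \<sigma> \<gamma> E" and Q: "is_cube Q" "Q \<inter> E \<noteq> {}" for E Q :: "(real ^ 'n) set"
  proof -
    let ?mass = "\<lambda>A. \<Sum>\<^sub>\<infinity>R\<in>A. measure lebesgue R / measure lebesgue Q"
    have cl: "closure E = E" using E(1) by simp
    have fill: "hole_filling \<sigma> \<delta> E" unfolding \<delta>_def by (rule weakly_porous_hole_filling[OF E(2,1)])
    \<comment> \<open>The yardstick for both scales: \<open>M\<close> bounds the large scale from
      above and \<open>c * M\<close> bounds the small scale from below.\<close>
    define M where "M = side_length (max_free_cube E Q)"
    obtain R0 where R0: "R0 \<in> dyadic Q" "R0 \<inter> closure E = {}" by (rule weakly_porous_free_cube[OF E(2) Q(1)])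
    note max = max_free_cube[OF R0]
    obtain p where p: "0 < M" "max_free_cube E Q = half_open_cube p M"
      using dyadic_is_cube(1)[OF max(1)] unfolding is_cube_def M_def by auto
    have hole: "has_hole E Q M"
      using dyadic_is_cube(2)[OF max(1)] max(2) unfolding has_hole_def p(2) cl by blast
    have "measure lebesgue (Q - free_union E Q (c * M)) \<le> (1 - \<sigma>) ^ m * measure lebesgue Q"
      unfolding c_def
      by (rule measure_Diff_free_union_power[OF fill assms(2) \<delta> \<kappa> _ Q(1) p(1) hole]) (use child fill in blast)
    moreover have "measure lebesgue (Q - free_union E Q (c * M)) =
        measure lebesgue Q - measure lebesgue (free_union E Q (c * M))"
      using free_union_lmeasurable[OF Q(1)] free_union_subset is_cube_lmeasurable[OF Q(1)]
      by (intro measurable_measure_Diff fmeasurableD) blast+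
    moreover have Qpos: "0 < measure lebesgue Q" by (rule measure_cube_pos[OF Q(1)])
    moreover have "(1 - \<sigma>) ^ m * measure lebesgue Q < s * measure lebesgue Q" using m Qpos by (rule mult_strict_right_mono)
    ultimately have "(1 - s) * measure lebesgue Q < measure lebesgue (free_union E Q (c * M))"
      unfolding left_diff_distrib mult_1 by linarith
    then have "1 - s < measure lebesgue (free_union E Q (c * M)) / measure lebesgue Q"
      using Qpos by (simp add: field_simps)
    then have big: "1 - s < ?mass {R \<in> dyadic_free E Q. c * M \<le> side_length R}"
      using dyadic_free_large_mass[OF E(1) Q, of "c * M"] c p(1) by simp
    then obtain R where "R \<in> dyadic_free E Q" "large_scale E Q s \<le> side_length R"
      using large_scale_attained[OF Q(1) \<open>0 < s\<close>, of "c * M" E] c p(1) s by auto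
    then have large: "large_scale E Q s \<le> M"
      using max_free_cube(3)[OF dyadic_freeD] unfolding M_def by fastforce
    have small: "c * M \<le> small_scale E Q s"
    proof (rule small_scale_attained[OF Q(1)])
      show "0 < c * M" using c p by simp
      have "?mass {R \<in> dyadic_free E Q. c * M \<le> side_length R} \<le> ?mass (dyadic_free E Q)"
        by (rule infsum_mono2) (auto intro!: dyadic_free_mass_summable[OF Q(1)])
      then show "s \<le> ?mass (dyadic_free E Q)" using big s by linarith
      fix L assume L: "s \<le> ?mass {R \<in> dyadic_free E Q. side_length R \<le> L}"
      show "c * M \<le> L"
      proof (rule ccontr)
        \<comment> \<open>For \<open>L < c * M\<close> the two families are disjoint, yet their
          masses add up to more than \<open>(1 - s) + s = 1\<close>.\<close>
        assume "\<not> c * M \<le> L"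
        then have "?mass {R \<in> dyadic_free E Q. c * M \<le> side_length R} +
            ?mass {R \<in> dyadic_free E Q. side_length R \<le> L} \<le> 1"
          by (intro dyadic_free_disjoint_mass_le[OF Q(1)]) auto
        then show False using big L by linarith
      qed
    qed
    have "M \<le> 1 / c * small_scale E Q s" using small c by (simp add: field_simps)
    then show ?thesis using large by linarith
  qed
  then show ?thesis using c by (intro exI[of _ "1 / c"]) auto
qed

end
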